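(* Let $m_1,m_2\ge 1$, $0<a<\infty$, and $\mathcal{D}=\{(x,t):0\le x<\infty,\ 0\le t<a\}$. Assume that the $m_1\times m_2$ matrix function $v\in C_{\varepsilon}(\mathcal{D})$ satisfies on $\mathcal{D}$ the matrix defocusing nonlinear Schrödinger equation $$2v_t=\mathrm{i}\,(v_{xx}-2vv^*v),$$ that for every $0\le t<a$ there is $M(t)\in(0,\infty)$ such that $$\sup_{x\in(0,\infty),\ 0\le s\le t}\|v(x,s)\|\le M(t),$$ and that the boundary values $v(0,t)$ and $v_x(0,t)$ belong to quasi-analytic classes $C([0,a);\widetilde M)$ and $C([0,a);\widetilde M^{+})$, respectively. Then $v$ is uniquely determined on $\mathcal{D}$ by the initial condition $v(x,0)=\mathcal{V}(x)$, $x\ge 0$. That is, for fixed quasi-analytic classes $C([0,a);\widetilde M)$ and $C([0,a);\widetilde M^{+})$, if two $m_1\times m_2$ matrix functions $v,u\in C_{\varepsilon}(\mathcal{D})$ both satisfy the equation $2v_t=\mathrm{i}\,(v_{xx}-2vv^*v)$, $2u_t=\mathrm{i}\,(u_{xx}-2uu^*u)$ on $\mathcal{D}$, if $\sup_{x\in(0,\infty),\ 0\le s\le t}\|v(x,s)\|<\infty$ and $\sup_{x\in(0,\infty),\ 0\le s\le t}\|u(x,s)\|<\infty$ for every $0\le t<a$, if $v(0,t),u(0,t)\in C([0,a);\widetilde M)$ and $v_x(0,t),u_x(0,t)\in C([0,a);\widetilde M^{+})$, and if $v(x,0)=u(x,0)$ for all $x\ge 0$, then $v=u$ on $\mathcal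{D}$.
   Context: Matrix functions are complex-valued; $v^*$ is the conjugate transpose; $\|\cdot\|$ is the matrix norm induced by the $l^2$ vector norm. On the boundary of a domain, derivatives are the appropriate one-sided derivatives. "Continuously differentiable" means differentiable with continuous first derivatives. Class $C_\varepsilon(\mathcal{D})$: the set of $m_1\times m_2$ matrix functions $v(x,t)$ on $\mathcal{D}$ which are continuously differentiable on $\mathcal{D}$, for which $v_{xx}$ exists on $\mathcal{D}$, and such that for each integer $k\geq 0$ there is $\varepsilon_k=\varepsilon_k(v)>0$ such that $v$ is $k$ times continuously differentiable with respect to $x$ in the square $\mathcal{D}(\varepsilon_k)=\{(x,t):0\le x\le\varepsilon_k,\ 0\le t\le\varepsilon_k\}\subset\mathcal{D}$. Quasi-analytic classes: for constants $\widetilde M_k>0$ ($k\ge0$), $C(\{\widetilde M_k\})$ is the class of all infinitely differentiable scalar functions $f$ on $[0,a)$ such that for some $c(f)\ge 0$ we have $\left|\frac{d^kf}{dx^k}(x)\right|\le c(f)^{k+1}\widetilde M_k$ for all $x\in[0,a)$ and all $k\ge 0$. This class is called quasi-analytic if for every $f$ in it and any $0\le x<a$ the equalities $\frac{d^kf}{dx^k}(x)=0$ for all $k\ge0$ imply $f\equiv0$. Given $\widetilde M=\{\widetilde M_k(i,j)\}$ such that for each $(i,j)$ the class $C(\{\widetilde M_k(i,j)\}_{k\ge0})$ is quasi-analytic, $v(0,t)\in C([0,a);\widetilde M)$ means that each entry $v_{ij}(0,t)$ belongs to $C(\{\widetilde M_k(i,j)\}_{k\ge 0})$. Similarly, $v_x(0,t)\in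 C([0,a);\widetilde M^+)$, $\widetilde M^+=\{\widetilde M^+_k(i,j)\}$, means that each entry $(v_{ij})_x(0,t)$ belongs to the quasi-analytic class $C(\{\widetilde M_k^+(i,j)\}_{k\ge 0})$. *)

theory Defs
  imports "HOL-Analysis.Analysis"
begin

text \<open>
  An \<open>m\<^sub>1 \<times> m\<^sub>2\<close> matrix has type \<^typ>\<open>complex^'m2^'m1\<close>. The library's \<^const>\<open>norm\<close> on this type is
  the Frobenius norm, so the norm induced by the \<open>l\<^sup>2\<close> vector norm is written with \<^const>\<open>onorm\<close>.
\<close>

definition op_norm :: "complex^'n^'m \<Rightarrow> real" where
  "op_norm A = onorm (\<lambda>z. A *v z)"

definition adjoint_mat :: "complex^'n^'m \<Rightarrow> complex^'m^'n" where
  "adjoint_mat A = map_matrix cnj (transpose A)"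

definition cscale_mat :: "complex \<Rightarrow> complex^'n^'m \<Rightarrow> complex^'n^'m" where
  "cscale_mat c A = map_matrix (\<lambda>z. c * z) A"


text \<open>
  Derivatives are taken within the domain, hence one-sided at its boundary points. Since
  \<^const>\<open>vector_derivative\<close> is total, existence is always demanded separately by
  \<open>differentiable\<close>.
\<close>

primrec iter_deriv :: "real set \<Rightarrow> nat \<Rightarrow> (real \<Rightarrow> 'b::real_normed_vector) \<Rightarrow> real \<Rightarrow> 'b" where
  "iter_deriv S 0 f = f"
| "iter_deriv S (Suc k) f = (\<lambda>x. vector_derivative (iter_deriv S k f) (at x within S))"

definition times_differentiable_on ::
    "nat \<Rightarrow> (real \<Rightarrow> 'b::real_normed_vector) \<Rightarrow> real set \<Rightarrow> bool" where
  "times_differentiable_on k f S \<longleftrightarrow>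
     (\<forall>j<k. \<forall>x\<in>S. iter_deriv S j f differentiable (at x within S))"

definition strip :: "real \<Rightarrow> (real \<times> real) set" where
  "strip a = {0..} \<times> {0..<a}"

definition square :: "real \<Rightarrow> (real \<times> real) set" where
  "square e = {0..e} \<times> {0..e}"

definition ddx :: "(real \<times> real \<Rightarrow> 'b::real_normed_vector) \<Rightarrow> real \<times> real \<Rightarrow> 'b" where
  "ddx v = (\<lambda>(x, t). vector_derivative (\<lambda>y. v (y, t)) (at x within {0..}))"

definition ddt :: "real \<Rightarrow> (real \<times> real \<Rightarrow> 'b::real_normed_vector) \<Rightarrow> real \<times> real \<Rightarrow> 'b" where
  "ddt a v = (\<lambda>(x, t). vector_derivative (\<lambda>s. v (x, s)) (at t within {0..<a}))"

definition continuously_differentiable_on_strip ::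
    "real \<Rightarrow> (real \<times> real \<Rightarrow> 'b::real_normed_vector) \<Rightarrow> bool" where
  "continuously_differentiable_on_strip a v \<longleftrightarrow>
     v differentiable_on strip a \<and>
     continuous_on (strip a) (ddx v) \<and> continuous_on (strip a) (ddt a v)"

text \<open>Continuity of the \<open>x\<close>-derivatives on the square is joint continuity in \<open>(x, t)\<close>.\<close>

definition times_cont_diff_x_on_square ::
    "nat \<Rightarrow> (real \<times> real \<Rightarrow> 'b::real_normed_vector) \<Rightarrow> real \<Rightarrow> bool" where
  "times_cont_diff_x_on_square k v e \<longleftrightarrow>
     (\<forall>t\<in>{0..e}. times_differentiable_on k (\<lambda>y. v (y, t)) {0..e}) \<and>
     (\<forall>j\<le>k. continuous_on (square e) (\<lambda>(x, t). iter_deriv {0..e} j (\<lambda>y. v (y, t)) x))"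

definition C_eps :: "real \<Rightarrow> (real \<times> real \<Rightarrow> complex^'n^'m) set" where
  "C_eps a = {v. continuously_differentiable_on_strip a v \<and>
     (\<forall>(x, t)\<in>strip a. (\<lambda>y. ddx v (y, t)) differentiable (at x within {0..})) \<and>
     (\<forall>k. \<exists>e>0. square e \<subseteq> strip a \<and> times_cont_diff_x_on_square k v e)}"

definition solves_dNLS :: "real \<Rightarrow> (real \<times> real \<Rightarrow> complex^'n^'m) \<Rightarrow> bool" where
  "solves_dNLS a v \<longleftrightarrow>
     (\<forall>p\<in>strip a. 2 *\<^sub>R ddt a v p =
        cscale_mat \<i> (ddx (ddx v) p - 2 *\<^sub>R (v p ** adjoint_mat (v p) ** v p)))"

definition locally_bounded_in_time :: "real \<Rightarrow> (real \<times> real \<Rightarrow> complex^'n^'m) \<Rightarrow> bool" where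
  "locally_bounded_in_time a v \<longleftrightarrow>
     (\<forall>t\<in>{0..<a}. \<exists>M>0. \<forall>x>0. \<forall>s\<in>{0..t}. op_norm (v (x, s)) \<le> M)"

definition deriv_class :: "real \<Rightarrow> (nat \<Rightarrow> real) \<Rightarrow> (real \<Rightarrow> complex) set" where
  "deriv_class a M = {f. (\<forall>k. times_differentiable_on k f {0..<a}) \<and>
     (\<exists>c\<ge>0. \<forall>x\<in>{0..<a}. \<forall>k. norm (iter_deriv {0..<a} k f x) \<le> c ^ (k + 1) * M k)}"

definition quasi_analytic :: "real \<Rightarrow> (nat \<Rightarrow> real) \<Rightarrow> bool" where
  "quasi_analytic a M \<longleftrightarrow>
     (\<forall>f\<in>deriv_class a M. \<forall>x\<in>{0..<a}.
        (\<forall>k. iter_deriv {0..<a} k f x = 0) \<longrightarrow> (\<forall>y\<in>{0..<a}. f y = 0))"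

definition matrix_deriv_class ::
    "real \<Rightarrow> ('m \<Rightarrow> 'n \<Rightarrow> nat \<Rightarrow> real) \<Rightarrow> (real \<Rightarrow> complex^'n^'m) set" where
  "matrix_deriv_class a M = {F. \<forall>i j. (\<lambda>t. F t $ i $ j) \<in> deriv_class a (M i j)}"

end

theory Submission
  imports Defs
begin

text \<open>
  Put \<open>w = v - u\<close>. Since \<open>w\<^sub>t\<close> is a combination of \<open>w\<^sub>x\<^sub>x\<close> and of products of \<open>w\<close> with smooth factors, and
  \<open>w\<close> vanishes at \<open>t = 0\<close>, integration in time shows inductively that near the corner \<open>(0, 0)\<close> all
  \<open>x\<close>-derivatives of \<open>w\<close> are \<open>O(t\<^sup>N)\<close> for every \<open>N\<close>. Hence all derivatives of \<open>w(0, t)\<close> and \<open>w\<^sub>x(0, t)\<close>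
  vanish at \<open>t = 0\<close>, and quasi-analyticity makes both functions vanish identically.

  Now \<open>w\<close> has zero Cauchy data on the line \<open>x = 0\<close>, which is noncharacteristic for the Schroedinger
  operator, and \<open>\<bar>w\<^sub>x\<^sub>x + 2\<i>w\<^sub>t\<bar> \<le> K\<bar>w\<bar>\<close> on compact sets. A Carleman estimate with a weight that is convex
  in \<open>x\<close> and concentrated around a given time then forces \<open>w = 0\<close>.
\<close>

section \<open>Vanishing at the corner\<close>

text \<open>Flatness is expressed by the bound \<open>C * t ^ N\<close> and not by vanishing mixed
  derivatives, because only one time derivative is assumed away from the edge x = 0. Each gain of
  one power of t spends two x-derivatives, through w_xx; hence all orders in x are carried along at
  once, and only near the corner, where \<open>C_eps\<close> grants them. On the edge, where the
  quasi-analytic classes supply smoothness in t, the bound is turned back into vanishing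
  derivatives.

  In the second half x is the evolution variable. The Carleman estimate is not a double integral but
  a monotonicity argument for an energy \<open>Q\<close> in x with \<open>Q 0 = 0\<close>. The
  weight decreases in x, so at the far edge x = X the energy is at least a multiple of -\<tau>^2 exp
  (2 \<tau>), while a nonzero value of w at some x1 < X would drive it down by an amount of size
  \<tau>^2 exp (4 \<tau>). The obstacle is regularity: w has one continuous time derivative and two
  x-derivatives but perhaps no mixed one, so the part of the energy that contains w_t cannot be
  differentiated under the integral sign.\<close>

lemma square_subset: "e \<le> e' \<Longrightarrow> square e \<subseteq> square e'"
  by (auto simp: square_def)

text \<open>
  \<open>flat_at_corner k N g\<close> says that \<open>g\<close> and its first \<open>k\<close> derivatives in \<open>x\<close> are continuous and
  \<open>O(t\<^sup>N)\<close> near \<open>(0, 0)\<close>. The square may shrink with the order of the derivative, as in the class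
  \<^const>\<open>C_eps\<close>.
\<close>

primrec flat_at_corner :: "nat \<Rightarrow> nat \<Rightarrow> (real \<times> real \<Rightarrow> 'b::real_normed_vector) \<Rightarrow> bool" where
  "flat_at_corner 0 N g \<longleftrightarrow>
     (\<exists>e>0. continuous_on (square e) g \<and> (\<exists>C. \<forall>(x, t)\<in>square e. norm (g (x, t)) \<le> C * t ^ N))"
| "flat_at_corner (Suc k) N g \<longleftrightarrow>
     (\<exists>e>0. continuous_on (square e) g \<and> (\<exists>C. \<forall>(x, t)\<in>square e. norm (g (x, t)) \<le> C * t ^ N)) \<and>
     (\<exists>g'. (\<exists>e>0. \<forall>(x, t)\<in>square e.
        ((\<lambda>y. g (y, t)) has_vector_derivative g' (x, t)) (at x within {0..e})) \<and>
        flat_at_corner k N g')"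

lemma flat_at_corner_0I:
  assumes "0 < e" "continuous_on (square e) g" "\<And>x t. (x, t) \<in> square e \<Longrightarrow> norm (g (x, t)) \<le> C * t ^ N"
  shows "flat_at_corner 0 N g"
  using assms by auto

lemma flat_at_corner_0E:
  assumes "flat_at_corner 0 N g"
  obtains e C where "0 < e" "0 \<le> C" "continuous_on (square e) g"
    "\<And>x t. (x, t) \<in> square e \<Longrightarrow> norm (g (x, t)) \<le> C * t ^ N"
proof -
  from assms obtain e C where e: "0 < e" "continuous_on (square e) g"
    "\<forall>(x, t)\<in>square e. norm (g (x, t)) \<le> C * t ^ N"
    by auto
  have "norm (g (x, t)) \<le> \<bar>C\<bar> * t ^ N" if "(x, t) \<in> square e" for x t
  proof -
    have "C * t ^ N \<le> \<bar>C\<bar> * t ^ N"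
      using that by (intro mult_right_mono) (auto simp: square_def)
    then show ?thesis
      using e(3) that by fastforce
  qed
  with e show thesis
    by (intro that[of e "\<bar>C\<bar>"]) auto
qed

lemma flat_at_corner_Suc:
  "flat_at_corner (Suc k) N g \<longleftrightarrow> flat_at_corner 0 N g \<and>
     (\<exists>g'. (\<exists>e>0. \<forall>(x, t)\<in>square e.
        ((\<lambda>y. g (y, t)) has_vector_derivative g' (x, t)) (at x within {0..e})) \<and>
        flat_at_corner k N g')"
  by simp

lemma flat_at_corner_SucE:
  assumes "flat_at_corner (Suc k) N g"
  obtains g' e where "0 < e" "flat_at_corner k N g'"
    "\<And>x t. (x, t) \<in> square e \<Longrightarrow>
        ((\<lambda>y. g (y, t)) has_vector_derivative g' (x, t)) (at x within {0..e})"
  using assms by fastforce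

declare flat_at_corner.simps [simp del]

lemma flat_at_corner_SucI:
  assumes "flat_at_corner 0 N g" "0 < e" "flat_at_corner k N g'"
    "\<And>x t. (x, t) \<in> square e \<Longrightarrow>
        ((\<lambda>y. g (y, t)) has_vector_derivative g' (x, t)) (at x within {0..e})"
  shows "flat_at_corner (Suc k) N g"
  unfolding flat_at_corner_Suc using assms by blast

lemma flat_at_corner_imp_0: "flat_at_corner k N g \<Longrightarrow> flat_at_corner 0 N g"
  by (cases k) (auto simp: flat_at_corner_Suc)

lemma flat_at_corner_lower: "flat_at_corner (Suc k) N g \<Longrightarrow> flat_at_corner k N g"
proof (induction k arbitrary: g)
  case 0
  then show ?case by (rule flat_at_corner_imp_0)
next
  case (Suc k)
  then show ?case
    unfolding flat_at_corner_Suc[of "Suc k" N g] flat_at_corner_Suc[of k N g] by blast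
qed

lemma has_vector_derivative_square_mono:
  assumes "\<And>x t. (x, t) \<in> square e \<Longrightarrow>
      ((\<lambda>y. g (y, t)) has_vector_derivative g' (x, t)) (at x within {0..e})"
    and "d \<le> e" "(x, t) \<in> square d"
  shows "((\<lambda>y. g (y, t)) has_vector_derivative g' (x, t)) (at x within {0..d})"
  by (rule has_vector_derivative_within_subset[OF assms(1)])
    (use assms(2,3) in \<open>auto simp: square_def\<close>)

text \<open>No induction on \<open>k\<close> is needed: on a smaller square both functions have the
  same derivative in x, so the witness \<open>g'\<close> for \<open>g\<close> also serves
  \<open>h\<close>.\<close>

lemma flat_at_corner_cong:
  assumes "flat_at_corner k N g" "0 < e" "\<And>p. p \<in> square e \<Longrightarrow> g p = h p"
  shows "flat_at_corner k N h"
proof -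
  have 0: "flat_at_corner 0 N h"
  proof -
    from flat_at_corner_imp_0[OF assms(1)] obtain d C where d: "0 < d" "continuous_on (square d) g"
      "\<And>x t. (x, t) \<in> square d \<Longrightarrow> norm (g (x, t)) \<le> C * t ^ N"
      by (rule flat_at_corner_0E) auto
    show ?thesis
    proof (rule flat_at_corner_0I[of "min d e"])
      have sub: "square (min d e) \<subseteq> square d" "square (min d e) \<subseteq> square e"
        by (auto intro!: square_subset)
      have "continuous_on (square (min d e)) g"
        using d(2) sub continuous_on_subset by blast
      then show "continuous_on (square (min d e)) h"
        by (rule continuous_on_eq) (use assms(3) sub in auto)
      show "norm (h (x, t)) \<le> C * t ^ N" if "(x, t) \<in> square (min d e)" for x t
        using d(3)[of x t] assms(3)[of "(x, t)"] subsetD[OF sub(1) that] subsetD[OF sub(2) that]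
        by metis
    qed (use d assms in auto)
  qed
  show ?thesis
  proof (cases k)
    case 0
    then show ?thesis using \<open>flat_at_corner 0 N h\<close> by simp
  next
    case (Suc j)
    from assms(1)[unfolded Suc] obtain g' d where d: "0 < d" "flat_at_corner j N g'"
      "\<And>x t. (x, t) \<in> square d \<Longrightarrow>
        ((\<lambda>y. g (y, t)) has_vector_derivative g' (x, t)) (at x within {0..d})"
      by (rule flat_at_corner_SucE) auto
    have "((\<lambda>y. h (y, t)) has_vector_derivative g' (x, t)) (at x within {0..min d e})"
      if xt: "(x, t) \<in> square (min d e)" for x t
    proof (rule has_vector_derivative_transform)
      show "((\<lambda>y. g (y, t)) has_vector_derivative g' (x, t)) (at x within {0..min d e})"
        by (rule has_vector_derivative_square_mono[OF d(3)]) (use xt in auto)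
      show "x \<in> {0..min d e}"
        using xt by (auto simp: square_def)
      show "h (y, t) = g (y, t)" if "y \<in> {0..min d e}" for y
        using assms(3)[of "(y, t)"] that xt by (auto simp: square_def)
    qed
    then show ?thesis
      unfolding Suc using 0 d assms(2) by (intro flat_at_corner_SucI[of N h "min d e" j g']) auto
  qed
qed

text \<open>The derivative in the definition of \<open>flat_at_corner\<close> is only asserted to
  exist. Derivatives within an interval of positive length are unique, so any function that is a
  derivative near the corner agrees with that witness there.\<close>

lemma flat_at_corner_derivative:
  assumes "flat_at_corner (Suc k) N g" "0 < e"
    and D: "\<And>x t. (x, t) \<in> square e \<Longrightarrow>
        ((\<lambda>y. g (y, t)) has_vector_derivative g' (x, t)) (at x within {0..e})"
  shows "flat_at_corner k N g'"
proof -
  from assms(1) obtain h d where d: "0 < d" "flat_at_corner k N h"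
    "\<And>x t. (x, t) \<in> square d \<Longrightarrow>
      ((\<lambda>y. g (y, t)) has_vector_derivative h (x, t)) (at x within {0..d})"
    by (rule flat_at_corner_SucE) auto
  have "h (x, t) = g' (x, t)" if xt: "(x, t) \<in> square (min d e)" for x t
  proof (rule vector_derivative_unique_within)
    show "at x within {0..min d e} \<noteq> bot"
      using xt d(1) assms(2) by (auto simp: trivial_limit_within islimpt_Icc square_def)
    show "((\<lambda>y. g (y, t)) has_vector_derivative h (x, t)) (at x within {0..min d e})"
      by (rule has_vector_derivative_square_mono[OF d(3)]) (use xt in auto)
    show "((\<lambda>y. g (y, t)) has_vector_derivative g' (x, t)) (at x within {0..min d e})"
      by (rule has_vector_derivative_square_mono[OF D]) (use xt in auto)
  qed
  with d assms show ?thesis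
    by (intro flat_at_corner_cong[of k N h "min d e" g']) auto
qed

section \<open>Algebra of functions that are flat at the corner\<close>

lemma flat_at_corner_add:
  assumes "flat_at_corner k N g" "flat_at_corner k N h"
  shows "flat_at_corner k N (\<lambda>p. g p + h p)"
  using assms
proof (induction k arbitrary: g h)
  case 0
  from 0(1) obtain d C where d: "0 < d" "0 \<le> C" "continuous_on (square d) g"
    "\<And>x t. (x, t) \<in> square d \<Longrightarrow> norm (g (x, t)) \<le> C * t ^ N"
    by (rule flat_at_corner_0E) auto
  from 0(2) obtain e D where e: "0 < e" "0 \<le> D" "continuous_on (square e) h"
    "\<And>x t. (x, t) \<in> square e \<Longrightarrow> norm (h (x, t)) \<le> D * t ^ N"
    by (rule flat_at_corner_0E) auto
  have sub: "square (min d e) \<subseteq> square d" "square (min d e) \<subseteq> square e"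
    by (auto intro!: square_subset)
  show ?case
  proof (rule flat_at_corner_0I[of "min d e"])
    show "continuous_on (square (min d e)) (\<lambda>p. g p + h p)"
      by (intro continuous_on_add continuous_on_subset[OF d(3)] continuous_on_subset[OF e(3)] sub)
    show "norm (g (x, t) + h (x, t)) \<le> (C + D) * t ^ N" if "(x, t) \<in> square (min d e)" for x t
      unfolding distrib_right using d(4)[of x t] e(4)[of x t] that sub
      by (intro norm_triangle_mono) auto
  qed (use d e in auto)
next
  case (Suc k)
  from Suc.prems(1) obtain g' d where d: "0 < d" "flat_at_corner k N g'"
    "\<And>x t. (x, t) \<in> square d \<Longrightarrow>
      ((\<lambda>y. g (y, t)) has_vector_derivative g' (x, t)) (at x within {0..d})"
    by (rule flat_at_corner_SucE) auto
  from Suc.prems(2) obtain h' e where e: "0 < e" "flat_at_corner k N h'"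
    "\<And>x t. (x, t) \<in> square e \<Longrightarrow>
      ((\<lambda>y. h (y, t)) has_vector_derivative h' (x, t)) (at x within {0..e})"
    by (rule flat_at_corner_SucE) auto
  show ?case
  proof (rule flat_at_corner_SucI[of _ _ "min d e"])
    show "flat_at_corner 0 N (\<lambda>p. g p + h p)"
      using Suc flat_at_corner_imp_0 flat_at_corner_lower by blast
    show "flat_at_corner k N (\<lambda>p. g' p + h' p)"
      using Suc.IH d e by blast
    show "((\<lambda>y. g (y, t) + h (y, t)) has_vector_derivative g' (x, t) + h' (x, t))
        (at x within {0..min d e})" if "(x, t) \<in> square (min d e)" for x t
      using that
      by (intro has_vector_derivative_add has_vector_derivative_square_mono[OF d(3)]
          has_vector_derivative_square_mono[OF e(3)]) auto
  qed (use d e in auto)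
qed

lemma flat_at_corner_bounded_linear:
  assumes L: "bounded_linear L" and "flat_at_corner k N g"
  shows "flat_at_corner k N (\<lambda>p. L (g p))"
  using assms(2)
proof (induction k arbitrary: g)
  case 0
  then obtain d C where d: "0 < d" "0 \<le> C" "continuous_on (square d) g"
    "\<And>x t. (x, t) \<in> square d \<Longrightarrow> norm (g (x, t)) \<le> C * t ^ N"
    by (rule flat_at_corner_0E) auto
  show ?case
  proof (rule flat_at_corner_0I[of d])
    show "continuous_on (square d) (\<lambda>p. L (g p))"
      by (rule bounded_linear.continuous_on[OF L d(3)])
    show "norm (L (g (x, t))) \<le> (onorm L * C) * t ^ N" if "(x, t) \<in> square d" for x t
    proof -
      have "norm (L (g (x, t))) \<le> onorm L * norm (g (x, t))"
        by (rule onorm[OF L])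
      also have "\<dots> \<le> onorm L * (C * t ^ N)"
        by (intro mult_left_mono d(4) that onorm_pos_le[OF L])
      finally show ?thesis by (simp add: mult.assoc)
    qed
  qed (use d in auto)
next
  case (Suc k)
  from Suc.prems(1) obtain g' d where d: "0 < d" "flat_at_corner k N g'"
    "\<And>x t. (x, t) \<in> square d \<Longrightarrow>
      ((\<lambda>y. g (y, t)) has_vector_derivative g' (x, t)) (at x within {0..d})"
    by (rule flat_at_corner_SucE) auto
  show ?case
  proof (rule flat_at_corner_SucI[of _ _ d])
    show "flat_at_corner 0 N (\<lambda>p. L (g p))"
      using Suc flat_at_corner_imp_0 flat_at_corner_lower by blast
    show "flat_at_corner k N (\<lambda>p. L (g' p))"
      using Suc.IH d by blast
    show "((\<lambda>y. L (g (y, t))) has_vector_derivative L (g' (x, t)))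
        (at x within {0..d})" if "(x, t) \<in> square d" for x t
      by (intro bounded_linear.has_vector_derivative[OF L] d(3) that)
  qed (use d in auto)
qed

text \<open>Product rule, with orders of vanishing adding up. It is applied with one of the two
  orders equal to 0: a factor that is merely smooth near the corner costs nothing.\<close>

lemma flat_at_corner_bounded_bilinear:
  assumes B: "bounded_bilinear B" and "flat_at_corner k N g" "flat_at_corner k N' h"
  shows "flat_at_corner k (N + N') (\<lambda>p. B (g p) (h p))"
  using assms(2,3)
proof (induction k arbitrary: g h)
  case 0
  from 0(1) obtain d C where d: "0 < d" "0 \<le> C" "continuous_on (square d) g"
    "\<And>x t. (x, t) \<in> square d \<Longrightarrow> norm (g (x, t)) \<le> C * t ^ N"
    by (rule flat_at_corner_0E) auto
  from 0(2) obtain e D where e: "0 < e" "0 \<le> D" "continuous_on (square e) h"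
    "\<And>x t. (x, t) \<in> square e \<Longrightarrow> norm (h (x, t)) \<le> D * t ^ N'"
    by (rule flat_at_corner_0E) auto
  from bounded_bilinear.pos_bounded[OF B] obtain K where K: "0 < K"
    "\<And>a b. norm (B a b) \<le> norm a * norm b * K" by blast
  have sub: "square (min d e) \<subseteq> square d" "square (min d e) \<subseteq> square e"
    by (auto intro!: square_subset)
  show ?case
  proof (rule flat_at_corner_0I[of "min d e"])
    show "continuous_on (square (min d e)) (\<lambda>p. B (g p) (h p))"
      by (intro bounded_bilinear.continuous_on[OF B] continuous_on_subset[OF d(3)]
          continuous_on_subset[OF e(3)] sub)
    show "norm (B (g (x, t)) (h (x, t))) \<le> (C * D * K) * t ^ (N + N')"
      if xt: "(x, t) \<in> square (min d e)" for x t
    proof -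
      have t: "0 \<le> t" using xt by (simp add: square_def)
      have "norm (B (g (x, t)) (h (x, t))) \<le> norm (g (x, t)) * norm (h (x, t)) * K"
        by (rule K)
      also have "\<dots> \<le> (C * t ^ N) * (D * t ^ N') * K"
        using d(4)[of x t] e(4)[of x t] xt sub K(1) t d(2) e(2)
        by (intro mult_right_mono mult_mono) auto
      finally show ?thesis by (simp add: power_add mult_ac)
    qed
  qed (use d e in auto)
next
  case (Suc k)
  from Suc.prems(1) obtain g' d where d: "0 < d" "flat_at_corner k N g'"
    "\<And>x t. (x, t) \<in> square d \<Longrightarrow>
      ((\<lambda>y. g (y, t)) has_vector_derivative g' (x, t)) (at x within {0..d})"
    by (rule flat_at_corner_SucE) auto
  from Suc.prems(2) obtain h' e where e: "0 < e" "flat_at_corner k N' h'"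
    "\<And>x t. (x, t) \<in> square e \<Longrightarrow>
      ((\<lambda>y. h (y, t)) has_vector_derivative h' (x, t)) (at x within {0..e})"
    by (rule flat_at_corner_SucE) auto
  note low = Suc.prems[THEN flat_at_corner_lower]
  show ?case
  proof (rule flat_at_corner_SucI[of _ _ "min d e"])
    show "flat_at_corner 0 (N + N') (\<lambda>p. B (g p) (h p))"
      using Suc.IH[OF low] by (rule flat_at_corner_imp_0)
    show "flat_at_corner k (N + N') (\<lambda>p. B (g p) (h' p) + B (g' p) (h p))"
      by (intro flat_at_corner_add Suc.IH low d e)
    show "((\<lambda>y. B (g (y, t)) (h (y, t))) has_vector_derivative
        B (g (x, t)) (h' (x, t)) + B (g' (x, t)) (h (x, t)))
        (at x within {0..min d e})" if "(x, t) \<in> square (min d e)" for x t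
      using that
      by (intro bounded_bilinear.has_vector_derivative[OF B] has_vector_derivative_square_mono[OF d(3)]
          has_vector_derivative_square_mono[OF e(3)]) auto
  qed (use d e in auto)
qed

text \<open>The length of the time interval is the additional power of t. For the x-derivatives,
  differentiation under the integral sign shows that the pair \<open>g'\<close>, \<open>r'\<close>
  satisfies the same hypotheses with one derivative less; that \<open>g\<close> has these
  derivatives at all is the content of its flatness of order 0.\<close>

lemma flat_at_corner_integral:
  fixes g r :: "real \<times> real \<Rightarrow> 'b::euclidean_space"
  assumes "flat_at_corner k 0 g" "flat_at_corner k N r" "0 < e"
    and "\<And>x t. (x, t) \<in> square e \<Longrightarrow> g (x, t) = integral {0..t} (\<lambda>s. r (x, s))"
  shows "flat_at_corner k (Suc N) g"
  using assms
proof (induction k arbitrary: g r e)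
  case (0 g r e)
  from 0(1) obtain d where d: "0 < d" "continuous_on (square d) g"
    by (rule flat_at_corner_0E) auto
  from 0(2) obtain e' C where e': "0 < e'" "0 \<le> C" "continuous_on (square e') r"
    "\<And>x t. (x, t) \<in> square e' \<Longrightarrow> norm (r (x, t)) \<le> C * t ^ N"
    by (rule flat_at_corner_0E) auto
  define m where "m = min d (min e e')"
  have sub: "square m \<subseteq> square d" "square m \<subseteq> square e" "square m \<subseteq> square e'"
    by (auto intro!: square_subset simp: m_def)
  have m: "m \<le> e'" "0 < m"
    using d e' 0(3) by (auto simp: m_def)
  show ?case
  proof (rule flat_at_corner_0I[of m])
    show "continuous_on (square m) g"
      by (rule continuous_on_subset[OF d(2) sub(1)])
    show "norm (g (x, t)) \<le> C * t ^ Suc N" if xt: "(x, t) \<in> square m" for x t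
    proof -
      have t: "0 \<le> t" "t \<le> e'" "0 \<le> x" "x \<le> e'" using xt m by (auto simp: square_def)
      have cont: "continuous_on {0..t} (\<lambda>s. r (x, s))"
        by (rule continuous_on_compose2[OF e'(3)])
          (use t in \<open>auto simp: square_def intro!: continuous_intros\<close>)
      have "norm (g (x, t)) = norm (integral {0..t} (\<lambda>s. r (x, s)))"
        using 0(4)[of x t] xt sub by auto
      also have "\<dots> \<le> (C * t ^ N) * (t - 0)"
      proof (rule integral_bound)
        show "norm (r (x, s)) \<le> C * t ^ N" if "s \<in> {0..t}" for s
        proof -
          have "norm (r (x, s)) \<le> C * s ^ N"
            using t that by (intro e'(4)) (auto simp: square_def)
          also have "\<dots> \<le> C * t ^ N"
            using that e'(2) by (intro mult_left_mono power_mono) auto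
          finally show ?thesis .
        qed
      qed (use t cont in auto)
      finally show ?thesis by (simp add: mult_ac)
    qed
  qed (use m in auto)
next
  case (Suc k g r e)
  from Suc.prems(1) obtain g' d where d: "0 < d" "flat_at_corner k 0 g'"
    "\<And>x t. (x, t) \<in> square d \<Longrightarrow>
      ((\<lambda>y. g (y, t)) has_vector_derivative g' (x, t)) (at x within {0..d})"
    by (rule flat_at_corner_SucE) auto
  from Suc.prems(2) obtain r' e' where e': "0 < e'" "flat_at_corner k N r'"
    "\<And>x t. (x, t) \<in> square e' \<Longrightarrow>
      ((\<lambda>y. r (y, t)) has_vector_derivative r' (x, t)) (at x within {0..e'})"
    by (rule flat_at_corner_SucE) auto
  from e'(2)[THEN flat_at_corner_imp_0] obtain c where c: "0 < c" "continuous_on (square c) r'"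
    by (rule flat_at_corner_0E) auto
  from Suc.prems(2)[THEN flat_at_corner_imp_0] obtain b where b: "0 < b" "continuous_on (square b) r"
    by (rule flat_at_corner_0E) auto
  \<comment> \<open>\<open>b\<close> and \<open>c\<close> enter because differentiation under the
    integral asks for \<open>r\<close> to be integrable in time and for \<open>r'\<close> to be
    jointly continuous.\<close>
  define m where "m = min b (min c (min d (min e e')))"
  have m: "m \<le> d" "m \<le> e" "m \<le> e'" "m \<le> c" "m \<le> b" "0 < m"
    using d e' Suc.prems c b by (auto simp: m_def)
  note sub = m(1-5)[THEN square_subset]
  have eq: "g' (x, t) = integral {0..t} (\<lambda>s. r' (x, s))" if xt: "(x, t) \<in> square m" for x t
  proof (rule vector_derivative_unique_within)
    have t: "0 \<le> t" "t \<le> m" "0 \<le> x" "x \<le> m" using xt by (auto simp: square_def)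
    show "at x within {0..m} \<noteq> bot"
      using t m by (auto simp: trivial_limit_within islimpt_Icc)
    show "((\<lambda>y. g (y, t)) has_vector_derivative g' (x, t)) (at x within {0..m})"
      by (rule has_vector_derivative_square_mono[OF d(3)]) (use m xt in auto)
    have "((\<lambda>x. integral (cbox 0 t) (\<lambda>s. r (x, s))) has_vector_derivative
        integral (cbox 0 t) (\<lambda>s. r' (x, s))) (at x within {0..m})"
    proof (rule leibniz_rule_vector_derivative)
      show "((\<lambda>y. r (y, s)) has_vector_derivative r' (y, s)) (at y within {0..m})"
        if "y \<in> {0..m}" "s \<in> cbox 0 t" for y s
        by (rule has_vector_derivative_square_mono[OF e'(3)])
          (use m t that in \<open>auto simp: square_def\<close>)
      show "(\<lambda>s. r (y, s)) integrable_on cbox 0 t" if "y \<in> {0..m}" for y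
        unfolding box_real
        by (rule integrable_continuous_real, rule continuous_on_compose2[OF b(2)])
          (use t m that in \<open>auto simp: square_def intro!: continuous_intros\<close>)
      show "continuous_on ({0..m} \<times> cbox 0 t) (\<lambda>(x, s). r' (x, s))"
        unfolding case_prod_eta
        by (rule continuous_on_subset[OF c(2)]) (use t m in \<open>auto simp: square_def\<close>)
    qed (use t in auto)
    then show "((\<lambda>y. g (y, t)) has_vector_derivative integral {0..t} (\<lambda>s. r' (x, s)))
        (at x within {0..m})"
      unfolding box_real
      by (rule has_vector_derivative_transform[rotated 2])
        (use t m Suc.prems(4) in \<open>auto simp: square_def\<close>)
  qed
  have 0: "flat_at_corner 0 (Suc N) g"
    using Suc.IH[OF Suc.prems(1,2)[THEN flat_at_corner_lower] Suc.prems(3,4)]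
    by (rule flat_at_corner_imp_0)
  show ?case
    by (rule flat_at_corner_SucI[OF 0 d(1) Suc.IH[OF d(2) e'(2) m(6) eq] d(3)])
qed

lemma has_vector_derivative_iter_deriv:
  assumes "times_differentiable_on k f S" "j < k" "x \<in> S"
  shows "(iter_deriv S j f has_vector_derivative iter_deriv S (Suc j) f x) (at x within S)"
  using assms by (auto simp: times_differentiable_on_def vector_derivative_works)

text \<open>The derivative of order j is shown to be flat with k - j derivatives left, by downward
  induction from j = k.\<close>

lemma times_cont_diff_x_flat_at_corner:
  assumes "times_cont_diff_x_on_square k v e" "0 < e"
  shows "flat_at_corner k 0 v"
proof -
  have "flat_at_corner (k - j) 0 (\<lambda>(x, t). iter_deriv {0..e} j (\<lambda>y. v (y, t)) x)" if "j \<le> k" for j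
    using that
  proof (induction j rule: inc_induct)
    have *: "flat_at_corner 0 0 (\<lambda>(x, t). iter_deriv {0..e} j (\<lambda>y. v (y, t)) x)" if "j \<le> k" for j
    proof -
      let ?f = "\<lambda>(x, t). iter_deriv {0..e} j (\<lambda>y. v (y, t)) x"
      have cont: "continuous_on (square e) ?f"
        using assms(1) that by (auto simp: times_cont_diff_x_on_square_def)
      \<comment> \<open>Order 0 only asks for boundedness, since \<open>t ^ 0 = 1\<close> also at t
        = 0; compactness provides it.\<close>
      have "compact (square e)"
        by (auto simp: square_def intro!: compact_Times)
      then have "bounded (?f ` square e)"
        using cont compact_continuous_image compact_imp_bounded by blast
      then obtain C where C: "\<And>p. p \<in> square e \<Longrightarrow> norm (?f p) \<le> C"
        unfolding bounded_iff by blast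
      show ?thesis
        by (rule flat_at_corner_0I[OF assms(2) cont, of C]) (use C in force)
    qed
    case base
    show ?case using *[of k] by simp
    case (step n)
    have "k - n = Suc (k - Suc n)" using step by simp
    moreover have "flat_at_corner (Suc (k - Suc n)) 0 (\<lambda>(x, t). iter_deriv {0..e} n (\<lambda>y. v (y, t)) x)"
    proof (rule flat_at_corner_SucI[OF _ assms(2) step.IH])
      show "flat_at_corner 0 0 (\<lambda>(x, t). iter_deriv {0..e} n (\<lambda>y. v (y, t)) x)"
        using *[of n] step by simp
      show "((\<lambda>y. case (y, t) of (x, t) \<Rightarrow> iter_deriv {0..e} n (\<lambda>y. v (y, t)) x) has_vector_derivative
            (case (x, t) of (x, t) \<Rightarrow> iter_deriv {0..e} (Suc n) (\<lambda>y. v (y, t)) x)) (at x within {0..e})"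
        if "(x, t) \<in> square e" for x t
      proof -
        have "times_differentiable_on k (\<lambda>y. v (y, t)) {0..e}"
          using assms(1) that by (auto simp: times_cont_diff_x_on_square_def square_def)
        from has_vector_derivative_iter_deriv[OF this, of n x] step that show ?thesis
          by (auto simp: square_def)
      qed
    qed
    ultimately show ?case by simp
  qed
  from this[of 0] show ?thesis
    by (simp add: case_prod_eta)
qed

section \<open>Matrix operations as real-linear maps, and the cubic nonlinearity\<close>

lemma bounded_linear_adjoint_mat: "bounded_linear (adjoint_mat :: complex^'n^'m \<Rightarrow> complex^'m^'n)"
  unfolding linear_conv_bounded_linear[symmetric]
  by (rule linearI) (auto simp: adjoint_mat_def map_matrix_def transpose_def vec_eq_iff complex_eq_iff)

lemma bounded_linear_cscale_mat: "bounded_linear (cscale_mat c :: complex^'n^'m \<Rightarrow> complex^'n^'m)"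
  unfolding linear_conv_bounded_linear[symmetric]
  by (rule linearI) (auto simp: cscale_mat_def map_matrix_def vec_eq_iff scaleR_conv_of_real algebra_simps)

lemma bounded_bilinear_matrix_matrix_mult:
  "bounded_bilinear ((**) :: complex^'n^'m \<Rightarrow> complex^'k^'n \<Rightarrow> complex^'k^'m)"
  unfolding bilinear_conv_bounded_bilinear[symmetric] bilinear_def
  by (auto intro!: linearI
      simp: matrix_matrix_mult_def vec_eq_iff sum.distrib algebra_simps scaleR_sum_right)

definition cubic :: "complex^'n^'m \<Rightarrow> complex^'n^'m" where
  "cubic A = A ** adjoint_mat A ** A"

text \<open>Telescoping: one factor at a time is replaced, so that every summand contains the
  difference exactly once.\<close>

lemma cubic_diff:
  fixes A B :: "complex^'n^'m"
  shows "cubic A - cubic B =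
    (A - B) ** adjoint_mat A ** A + B ** adjoint_mat (A - B) ** A + B ** adjoint_mat B ** (A - B)"
proof -
  interpret mm: bounded_bilinear "(**) :: complex^'n^'m \<Rightarrow> complex^'m^'n \<Rightarrow> complex^'m^'m"
    by (rule bounded_bilinear_matrix_matrix_mult)
  interpret nn: bounded_bilinear "(**) :: complex^'m^'m \<Rightarrow> complex^'n^'m \<Rightarrow> complex^'n^'m"
    by (rule bounded_bilinear_matrix_matrix_mult)
  show ?thesis
    by (simp add: cubic_def linear_diff[OF bounded_linear.linear[OF bounded_linear_adjoint_mat]] mm.diff_left mm.diff_right
        nn.diff_left nn.diff_right)
qed

section \<open>Partial derivatives of functions in \<open>C_eps\<close>\<close>

lemma strip_iff: "(x, t) \<in> strip a \<longleftrightarrow> 0 \<le> x \<and> 0 \<le> t \<and> t < a"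
  by (auto simp: strip_def)

text \<open>\<open>C_eps\<close> asks for differentiability in the pair (x, t); the chain rule along
  the horizontal line through (x, t) yields the partial derivative.\<close>

lemma C_eps_has_ddx:
  assumes "v \<in> C_eps a" "(x, t) \<in> strip a"
  shows "((\<lambda>y. v (y, t)) has_vector_derivative ddx v (x, t)) (at x within {0..})"
proof -
  have "v differentiable (at (x, t) within strip a)"
    using assms by (auto simp: C_eps_def continuously_differentiable_on_strip_def differentiable_on_def)
  then have "v differentiable (at ((\<lambda>y. (y, t)) x) within (\<lambda>y. (y, t)) ` {0..})"
    by (rule differentiable_within_subset) (use assms(2) in \<open>auto simp: strip_def\<close>)
  moreover have "(\<lambda>y. (y, t)) differentiable (at x within {0..})"
    by (rule differentiableI) (auto intro!: derivative_eq_intros)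
  ultimately have "(v \<circ> (\<lambda>y. (y, t))) differentiable (at x within {0..})"
    by (rule differentiable_chain_within[rotated])
  then show ?thesis
    by (simp add: ddx_def vector_derivative_works o_def)
qed

lemma C_eps_has_ddt:
  assumes "v \<in> C_eps a" "(x, t) \<in> strip a"
  shows "((\<lambda>s. v (x, s)) has_vector_derivative ddt a v (x, t)) (at t within {0..<a})"
proof -
  have "v differentiable (at (x, t) within strip a)"
    using assms by (auto simp: C_eps_def continuously_differentiable_on_strip_def differentiable_on_def)
  then have "v differentiable (at ((\<lambda>s. (x, s)) t) within (\<lambda>s. (x, s)) ` {0..<a})"
    by (rule differentiable_within_subset) (use assms(2) in \<open>auto simp: strip_def\<close>)
  moreover have "(\<lambda>s. (x, s)) differentiable (at t within {0..<a})"
    by (rule differentiableI) (auto intro!: derivative_eq_intros)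
  ultimately have "(v \<circ> (\<lambda>s. (x, s))) differentiable (at t within {0..<a})"
    by (rule differentiable_chain_within[rotated])
  then show ?thesis
    by (simp add: ddt_def vector_derivative_works o_def)
qed

lemma C_eps_has_ddxx:
  assumes "v \<in> C_eps a" "(x, t) \<in> strip a"
  shows "((\<lambda>y. ddx v (y, t)) has_vector_derivative ddx (ddx v) (x, t)) (at x within {0..})"
proof -
  have "(\<lambda>y. ddx v (y, t)) differentiable (at x within {0..})"
    using assms by (auto simp: C_eps_def)
  then show ?thesis
    unfolding vector_derivative_works by (subst (2) ddx_def) simp
qed

lemma C_eps_continuous_on:
  assumes "v \<in> C_eps a"
  shows "continuous_on (strip a) v" "continuous_on (strip a) (ddx v)" "continuous_on (strip a) (ddt a v)"
  using assms
  by (auto simp: C_eps_def continuously_differentiable_on_strip_def intro: differentiable_imp_continuous_on)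

lemma C_eps_flat_at_corner: "v \<in> C_eps a \<Longrightarrow> flat_at_corner k 0 v"
  by (auto simp: C_eps_def intro: times_cont_diff_x_flat_at_corner)

section \<open>The equation for the difference of two solutions\<close>

lemma dNLS_difference:
  assumes "solves_dNLS a v" "solves_dNLS a u" "p \<in> strip a"
  shows "ddt a v p - ddt a u p = (1/2) *\<^sub>R cscale_mat \<i>
    ((ddx (ddx v) p - ddx (ddx u) p) + (- 2) *\<^sub>R (cubic (v p) - cubic (u p)))"
proof -
  have "2 *\<^sub>R ddt a v p = cscale_mat \<i> (ddx (ddx v) p - 2 *\<^sub>R cubic (v p))"
    "2 *\<^sub>R ddt a u p = cscale_mat \<i> (ddx (ddx u) p - 2 *\<^sub>R cubic (u p))"
    using assms by (auto simp: solves_dNLS_def cubic_def)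
  then have "2 *\<^sub>R (ddt a v p - ddt a u p) = cscale_mat \<i>
    ((ddx (ddx v) p - 2 *\<^sub>R cubic (v p)) - (ddx (ddx u) p - 2 *\<^sub>R cubic (u p)))"
    by (simp only: scaleR_diff_right linear_diff[OF bounded_linear.linear[OF bounded_linear_cscale_mat]])
  also have "(ddx (ddx v) p - 2 *\<^sub>R cubic (v p)) - (ddx (ddx u) p - 2 *\<^sub>R cubic (u p))
     = (ddx (ddx v) p - ddx (ddx u) p) + (- 2) *\<^sub>R (cubic (v p) - cubic (u p))"
    by (simp add: algebra_simps)
  finally have "(1/2) *\<^sub>R (2 *\<^sub>R (ddt a v p - ddt a u p)) = (1/2) *\<^sub>R cscale_mat \<i>
    ((ddx (ddx v) p - ddx (ddx u) p) + (- 2) *\<^sub>R (cubic (v p) - cubic (u p)))"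
    by (rule arg_cong)
  then show ?thesis by simp
qed

text \<open>Order \<open>Suc N\<close> for \<open>k\<close> derivatives of w rests on order
  \<open>N\<close> for \<open>k\<close> derivatives of w_t, hence of w_xx, hence on order
  \<open>N\<close> for k + 2 derivatives of w. This is why \<open>k\<close> is arbitrary in the
  induction on \<open>N\<close>.\<close>

lemma dNLS_difference_flat_at_corner:
  fixes v u :: "real \<times> real \<Rightarrow> complex^'n^'m"
  assumes "0 < a" and v: "v \<in> C_eps a" and u: "u \<in> C_eps a"
    and pde: "solves_dNLS a v" "solves_dNLS a u"
    and init: "\<And>x. 0 \<le> x \<Longrightarrow> v (x, 0) = u (x, 0)"
  shows "flat_at_corner k N (\<lambda>p. v p - u p)"
proof -
  have flat0: "flat_at_corner k 0 (\<lambda>p. v p - u p)" for k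
  proof -
    have "flat_at_corner k 0 (\<lambda>p. v p + (- 1) *\<^sub>R u p)"
      by (intro flat_at_corner_add flat_at_corner_bounded_linear[OF bounded_linear_scaleR_right]
          C_eps_flat_at_corner[OF v] C_eps_flat_at_corner[OF u])
    then show ?thesis by simp
  qed
  note mult = flat_at_corner_bounded_bilinear[OF bounded_bilinear_matrix_matrix_mult]
  note adj = flat_at_corner_bounded_linear[OF bounded_linear_adjoint_mat]
  \<comment> \<open>Half of \<open>a\<close>, since the strip is open at t = a while squares are
    closed.\<close>
  have in_strip: "(x, t) \<in> strip a" if "(x, t) \<in> square (a / 2)" for x t
    using that assms(1) by (auto simp: square_def strip_def)
  show ?thesis
  proof (induction N arbitrary: k)
    case 0
    show ?case by (rule flat0)
  next
    case (Suc N)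
    note V = C_eps_flat_at_corner[OF v, of k] and U = C_eps_flat_at_corner[OF u, of k] and W = Suc.IH[of k]
    have "flat_at_corner k N (\<lambda>p. (v p - u p) ** adjoint_mat (v p) ** v p)"
      "flat_at_corner k N (\<lambda>p. u p ** adjoint_mat (v p - u p) ** v p)"
      "flat_at_corner k N (\<lambda>p. u p ** adjoint_mat (u p) ** (v p - u p))"
      using mult[OF mult[OF W adj[OF V]] V] mult[OF mult[OF U adj[OF W]] V]
        mult[OF mult[OF U adj[OF U]] W] by simp_all
    then have cub: "flat_at_corner k N (\<lambda>p. cubic (v p) - cubic (u p))"
      unfolding cubic_diff by (intro flat_at_corner_add)
    have "flat_at_corner (Suc k) N (\<lambda>p. ddx v p - ddx u p)"
    proof (rule flat_at_corner_derivative[OF Suc.IH, of "a / 2"])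
      show "((\<lambda>y. v (y, t) - u (y, t)) has_vector_derivative ddx v (x, t) - ddx u (x, t))
          (at x within {0..a / 2})" if "(x, t) \<in> square (a / 2)" for x t
        by (rule has_vector_derivative_within_subset[of _ _ _ "{0..}"])
          (auto intro!: has_vector_derivative_diff C_eps_has_ddx[OF v] C_eps_has_ddx[OF u] in_strip that)
    qed (use assms in auto)
    then have dd: "flat_at_corner k N (\<lambda>p. ddx (ddx v) p - ddx (ddx u) p)"
    proof (rule flat_at_corner_derivative[of _ _ _ "a / 2"])
      show "((\<lambda>y. ddx v (y, t) - ddx u (y, t)) has_vector_derivative ddx (ddx v) (x, t) - ddx (ddx u) (x, t))
          (at x within {0..a / 2})" if "(x, t) \<in> square (a / 2)" for x t
        by (rule has_vector_derivative_within_subset[of _ _ _ "{0..}"])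
          (auto intro!: has_vector_derivative_diff C_eps_has_ddxx[OF v] C_eps_has_ddxx[OF u] in_strip that)
    qed (use assms in auto)
    have r: "flat_at_corner k N (\<lambda>p. (1/2) *\<^sub>R cscale_mat \<i>
      ((ddx (ddx v) p - ddx (ddx u) p) + (- 2) *\<^sub>R (cubic (v p) - cubic (u p))))"
      by (intro flat_at_corner_bounded_linear[OF bounded_linear_scaleR_right]
          flat_at_corner_bounded_linear[OF bounded_linear_cscale_mat] flat_at_corner_add dd cub)
    have "flat_at_corner k N (\<lambda>p. ddt a v p - ddt a u p)"
    proof (rule flat_at_corner_cong[OF r, of "a / 2"])
      show "(1/2) *\<^sub>R cscale_mat \<i>
        ((ddx (ddx v) p - ddx (ddx u) p) + (- 2) *\<^sub>R (cubic (v p) - cubic (u p)))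
        = ddt a v p - ddt a u p" if "p \<in> square (a / 2)" for p
        using that in_strip by (cases p) (metis dNLS_difference[OF pde])
    qed (use assms in auto)
    then show ?case
    proof (rule flat_at_corner_integral[where e = "a / 2", OF flat0])
      fix x t assume xt: "(x, t) \<in> square (a / 2)"
      then have t: "0 \<le> t" "t < a" "0 \<le> x" using assms(1) by (auto simp: square_def)
      have "((\<lambda>s. ddt a v (x, s) - ddt a u (x, s)) has_integral
          (v (x, t) - u (x, t)) - (v (x, 0) - u (x, 0))) {0..t}"
      proof (rule fundamental_theorem_of_calculus)
        show "((\<lambda>s. v (x, s) - u (x, s)) has_vector_derivative ddt a v (x, s) - ddt a u (x, s))
            (at s within {0..t})" if "s \<in> {0..t}" for s
          by (rule has_vector_derivative_within_subset[of _ _ _ "{0..<a}"])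
            (use t that in \<open>auto simp: strip_iff
              intro!: has_vector_derivative_diff C_eps_has_ddt[OF v] C_eps_has_ddt[OF u]\<close>)
      qed (use t in auto)
      then show "v (x, t) - u (x, t) = integral {0..t} (\<lambda>s. ddt a v (x, s) - ddt a u (x, s))"
        using init[of x] t by (simp add: integral_unique)
    qed (use assms in auto)
  qed
qed

section \<open>Flat functions and quasi-analytic classes\<close>

definition flat_at_0 :: "(real \<Rightarrow> 'b::real_normed_vector) \<Rightarrow> bool" where
  "flat_at_0 f \<longleftrightarrow> (\<forall>N. \<exists>C. \<forall>\<^sub>F t in at_right 0. norm (f t) \<le> C * t ^ N)"

text \<open>Order one already suffices. Flatness constrains only t > 0, so the value at 0 is reached
  through a right limit.\<close>

lemma flat_at_0_zero:
  assumes "flat_at_0 f" "(f \<longlongrightarrow> L) (at_right 0)"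
  shows "L = 0"
proof -
  from assms(1) obtain C where "\<forall>\<^sub>F t in at_right 0. norm (f t) \<le> C * t ^ 1"
    unfolding flat_at_0_def by blast
  moreover have "((\<lambda>t. C * t ^ 1) \<longlongrightarrow> 0) (at_right (0::real))"
    by (auto intro!: tendsto_eq_intros)
  ultimately have "(f \<longlongrightarrow> 0) (at_right 0)"
    by (rule Lim_null_comparison)
  with assms(2) show ?thesis
    by (rule tendsto_unique[OF trivial_limit_at_right_real])
qed

text \<open>A step of length \<open>t\<^sup>m\<close> in Taylor's formula trades half of the order of vanishing for a derivative.\<close>

lemma flat_at_0_derivative:
  fixes g :: "real \<Rightarrow> 'b::real_normed_vector"
  assumes "0 < a" "flat_at_0 g"
    and g: "\<And>t. t \<in> {0..<a} \<Longrightarrow> (g has_vector_derivative g' t) (at t within {0..<a})"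
    and g': "\<And>t. t \<in> {0..<a} \<Longrightarrow> (g' has_vector_derivative g'' t) (at t within {0..<a})"
    and g'': "continuous_on {0..<a} g''"
  shows "flat_at_0 g'"
  unfolding flat_at_0_def
proof
  fix N
  \<comment> \<open>At least 1, so that the step \<open>h = t ^ m\<close> is at most t, and at least
    \<open>N\<close>, so that \<open>t ^ m\<close> is at most \<open>t ^ N\<close> for t <
    1.\<close>
  define m where "m = Suc N"
  from assms(2) obtain C where "\<forall>\<^sub>F t in at_right 0. norm (g t) \<le> C * t ^ (2 * m)"
    unfolding flat_at_0_def by blast
  then obtain d where d: "0 < d" "\<And>t. 0 < t \<Longrightarrow> t < d \<Longrightarrow> norm (g t) \<le> C * t ^ (2 * m)"
    unfolding eventually_at_right_field by blast
  \<comment> \<open>Below 1 for the comparison of powers of t; twice \<open>e\<close> stays below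
    \<open>d\<close> and \<open>a\<close>, so that t + h remains where \<open>g\<close> is small and
    differentiable.\<close>
  define e where "e = min 1 (min d a) / 3"
  have e: "0 < e" "e < 1" "2 * e < d" "2 * e < a"
    using d(1) assms(1) by (auto simp: e_def min_def)
  have "compact (g'' ` {0..2 * e})"
    by (rule compact_continuous_image[OF continuous_on_subset[OF g'']]) (use e in auto)
  then have "bounded (g'' ` {0..2 * e})"
    by (rule compact_imp_bounded)
  then obtain B where B: "\<And>t. t \<in> {0..2 * e} \<Longrightarrow> norm (g'' t) \<le> B"
    unfolding bounded_iff by blast
  have B0: "0 \<le> B" using B[of 0] e norm_ge_zero[of "g'' 0"] by (smt (verit) atLeastAtMost_iff)
  have C0: "0 \<le> C"
  proof (rule ccontr)
    assume "\<not> 0 \<le> C"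
    then have "C * e ^ (2 * m) < 0"
      using e(1) by (intro mult_neg_pos) auto
    then show False
      using d(2)[of e] e norm_ge_zero[of "g e"] by linarith
  qed
  define K where "K = C * (1 + 2 ^ (2 * m)) + B"
  have "norm (g' t) \<le> K * t ^ N" if t: "0 < t" "t < e" for t
  proof -
    define h where "h = t ^ m"
    have h: "0 < h" "h \<le> t"
      using t e by (auto simp: h_def m_def mult_left_le power_le_one)
    have sub: "{t..t + h} \<subseteq> {0..<a}" "{t..t + h} \<subseteq> {0..2 * e}"
      using t h e by auto
    have g'_diff: "norm (g' s - g' t) \<le> h * B" if s: "s \<in> {t..t + h}" for s
    proof -
      have "norm (g' s - g' t) \<le> B * norm (s - t)"
      proof (rule differentiable_bound)
        show "(g' has_derivative (\<lambda>r. r *\<^sub>R g'' x)) (at x within {t..t + h})" if "x \<in> {t..t + h}" for x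
          using g'[of x] that sub has_derivative_subset unfolding has_vector_derivative_def by blast
        show "onorm (\<lambda>r. r *\<^sub>R g'' x) \<le> B" if "x \<in> {t..t + h}" for x
        proof (rule onorm_le)
          show "norm (r *\<^sub>R g'' x) \<le> B * norm r" for r
            using B[of x] that sub mult_right_mono[of "norm (g'' x)" B "\<bar>r\<bar>"]
            by (auto simp: mult.commute)
        qed
      qed (use s h in auto)
      also have "\<dots> \<le> B * h"
        using s B0 by (intro mult_left_mono) auto
      finally show ?thesis by (simp add: mult.commute)
    qed
    have "norm (g (t + h) - g t - (t + h - t) *\<^sub>R g' t) \<le> norm (t + h - t) * (h * B)"
    proof (rule vector_differentiable_bound_linearization[of "{t..t + h}"])
      show "(g has_vector_derivative g' x) (at x within {t..t + h})" if "x \<in> {t..t + h}" for x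
        using g[of x] that sub has_vector_derivative_within_subset by blast
    qed (use g'_diff h in \<open>auto simp: closed_segment_eq_real_ivl\<close>)
    then have lin: "norm (g (t + h) - g t - h *\<^sub>R g' t) \<le> B * h ^ 2"
      using h by (simp add: power2_eq_square mult_ac)
    have pw: "h ^ 2 = t ^ (2 * m)"
      by (simp add: h_def power_mult [symmetric] mult.commute)
    \<comment> \<open>The vector h g'(t) is an increment of \<open>g\<close> minus a Taylor
      remainder. As \<open>h ^ 2 = t ^ (2 * m)\<close>, all contributions are bounded by multiples
      of h^2, and one factor h cancels.\<close>
    have "h * norm (g' t) = norm (h *\<^sub>R g' t)"
      using h by simp
    also have "\<dots> = norm (g (t + h) - g t - (g (t + h) - g t - h *\<^sub>R g' t))"
      by simp
    also have "\<dots> \<le> norm (g (t + h)) + norm (g t) + norm (g (t + h) - g t - h *\<^sub>R g' t)"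
      by (rule order_trans[OF norm_triangle_ineq4]) (simp add: norm_triangle_ineq4)
    also have "\<dots> \<le> C * (t + h) ^ (2 * m) + C * t ^ (2 * m) + B * h ^ 2"
      by (intro add_mono d(2) lin) (use t h e in auto)
    also have "C * (t + h) ^ (2 * m) \<le> C * (2 * t) ^ (2 * m)"
      using h t C0 by (intro mult_left_mono power_mono) auto
    also have "C * (2 * t) ^ (2 * m) + C * t ^ (2 * m) + B * h ^ 2 = K * h * h"
      unfolding power_mult_distrib pw[symmetric] K_def by (simp add: power2_eq_square algebra_simps)
    finally have "h * norm (g' t) \<le> h * (K * h)" by (simp add: mult_ac)
    then have "norm (g' t) \<le> K * h"
      using h by simp
    also have "\<dots> \<le> K * t ^ N"
      using t e C0 B0 unfolding h_def m_def K_def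
      by (intro mult_left_mono power_decreasing) auto
    finally show ?thesis .
  qed
  then have "\<forall>\<^sub>F t in at_right 0. norm (g' t) \<le> K * t ^ N"
    unfolding eventually_at_right_field using e(1) by blast
  then show "\<exists>C. \<forall>\<^sub>F t in at_right 0. norm (g' t) \<le> C * t ^ N" ..
qed

section \<open>Iterated derivatives and uniqueness in quasi-analytic classes\<close>

lemma at_within_Ico_neq_bot: "x \<in> {0..<a} \<Longrightarrow> at x within {0..<a::real} \<noteq> bot"
  by (auto simp: trivial_limit_within islimpt_Ico)

lemma iter_deriv_diff:
  assumes "\<And>k. times_differentiable_on k f {0..<a}" "\<And>k. times_differentiable_on k g {0..<a}"
    and "x \<in> {0..<a}"
  shows "iter_deriv {0..<a} k (\<lambda>t. f t - g t) x = iter_deriv {0..<a} k f x - iter_deriv {0..<a} k g x"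
    and "(iter_deriv {0..<a} k (\<lambda>t. f t - g t) has_vector_derivative
      iter_deriv {0..<a} (Suc k) f x - iter_deriv {0..<a} (Suc k) g x) (at x within {0..<a})"
proof -
  have D: "((\<lambda>t. iter_deriv {0..<a} k f t - iter_deriv {0..<a} k g t) has_vector_derivative
      iter_deriv {0..<a} (Suc k) f x - iter_deriv {0..<a} (Suc k) g x) (at x within {0..<a})"
    if "x \<in> {0..<a}" for x k
    using has_vector_derivative_iter_deriv[OF assms(1), of k "Suc k"]
      has_vector_derivative_iter_deriv[OF assms(2), of k "Suc k"] that
    by (intro has_vector_derivative_diff) auto
  have eq: "iter_deriv {0..<a} k (\<lambda>t. f t - g t) x = iter_deriv {0..<a} k f x - iter_deriv {0..<a} k g x"
    if "x \<in> {0..<a}" for x k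
    using that
  proof (induction k arbitrary: x)
    case (Suc k)
    have "(iter_deriv {0..<a} k (\<lambda>t. f t - g t) has_vector_derivative
      iter_deriv {0..<a} (Suc k) f x - iter_deriv {0..<a} (Suc k) g x) (at x within {0..<a})"
      by (rule has_vector_derivative_transform[OF Suc.prems Suc.IH D[OF Suc.prems]])
    from vector_derivative_within[OF at_within_Ico_neq_bot[OF Suc.prems] this] show ?case
      by simp
  qed simp
  from eq[OF assms(3)] show "iter_deriv {0..<a} k (\<lambda>t. f t - g t) x
    = iter_deriv {0..<a} k f x - iter_deriv {0..<a} k g x" .
  show "(iter_deriv {0..<a} k (\<lambda>t. f t - g t) has_vector_derivative
      iter_deriv {0..<a} (Suc k) f x - iter_deriv {0..<a} (Suc k) g x) (at x within {0..<a})"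
    by (rule has_vector_derivative_transform[OF assms(3) eq D[OF assms(3)]])
qed

text \<open>The free geometric factor absorbs sums, because c^(k+1) + b^(k+1) is at most (c +
  b)^(k+1). Thus quasi-analyticity can be applied to a difference of two members.\<close>

lemma deriv_class_diff:
  assumes "f \<in> deriv_class a M" "g \<in> deriv_class a M" "\<And>k. 0 \<le> M k"
  shows "(\<lambda>t. f t - g t) \<in> deriv_class a M"
proof -
  from assms(1) obtain c where f: "\<And>k. times_differentiable_on k f {0..<a}" "0 \<le> c"
    "\<And>x k. x \<in> {0..<a} \<Longrightarrow> norm (iter_deriv {0..<a} k f x) \<le> c ^ (k + 1) * M k"
    by (auto simp: deriv_class_def)
  from assms(2) obtain b where g: "\<And>k. times_differentiable_on k g {0..<a}" "0 \<le> b"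
    "\<And>x k. x \<in> {0..<a} \<Longrightarrow> norm (iter_deriv {0..<a} k g x) \<le> b ^ (k + 1) * M k"
    by (auto simp: deriv_class_def)
  note D = iter_deriv_diff[OF f(1) g(1)]
  have "times_differentiable_on k (\<lambda>t. f t - g t) {0..<a}" for k
    unfolding times_differentiable_on_def
    using D(2) by (blast intro: differentiableI_vector)
  moreover have "norm (iter_deriv {0..<a} k (\<lambda>t. f t - g t) x) \<le> (c + b) ^ (k + 1) * M k"
    if "x \<in> {0..<a}" for x k
  proof -
    have "norm (iter_deriv {0..<a} k (\<lambda>t. f t - g t) x) \<le> c ^ (k + 1) * M k + b ^ (k + 1) * M k"
      unfolding D(1)[OF that] using f(3)[OF that] g(3)[OF that]
      by (rule order_trans[OF norm_triangle_ineq4 add_mono])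
    also have "\<dots> \<le> (c + b) ^ (k + 1) * M k"
    proof -
      have "c * c ^ k + b * b ^ k \<le> c * (c + b) ^ k + b * (c + b) ^ k"
        using f(2) g(2) by (intro add_mono mult_left_mono power_mono) auto
      then have "c ^ (k + 1) + b ^ (k + 1) \<le> (c + b) ^ (k + 1)"
        by (simp add: distrib_right)
      then show ?thesis
        using assms(3)[of k] by (metis distrib_right mult_right_mono)
    qed
    finally show ?thesis .
  qed
  ultimately show ?thesis
    unfolding deriv_class_def using f(2) g(2) by (auto intro!: exI[of _ "c + b"])
qed

text \<open>Iteration of \<open>flat_at_0_derivative\<close>; the continuity it requires of the
  second derivative follows from the existence of the third.\<close>

lemma flat_at_0_iter_deriv:
  assumes "0 < a" "\<And>k. times_differentiable_on k f {0..<a}" "flat_at_0 f"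
  shows "flat_at_0 (iter_deriv {0..<a} k f)"
proof (induction k)
  case 0
  show ?case using assms(3) by simp
next
  case (Suc k)
  have D: "(iter_deriv {0..<a} j f has_vector_derivative iter_deriv {0..<a} (Suc j) f t) (at t within {0..<a})"
    if "t \<in> {0..<a}" for j t
    using has_vector_derivative_iter_deriv[OF assms(2), of j "Suc j"] that by auto
  show ?case
  proof (rule flat_at_0_derivative[OF assms(1) Suc D D])
    show "continuous_on {0..<a} (iter_deriv {0..<a} (Suc (Suc k)) f)"
      unfolding continuous_on_eq_continuous_within
      using D has_vector_derivative_continuous by blast
  qed
qed

lemma quasi_analytic_unique:
  assumes "0 < a" "quasi_analytic a M" "\<And>k. 0 \<le> M k"
    and "f \<in> deriv_class a M" "g \<in> deriv_class a M"
    and flat: "flat_at_0 (\<lambda>t. f t - g t)"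
    and t: "t \<in> {0..<a}"
  shows "f t = g t"
proof -
  let ?h = "\<lambda>t. f t - g t"
  have h: "?h \<in> deriv_class a M"
    using assms by (intro deriv_class_diff)
  then have diff: "times_differentiable_on k ?h {0..<a}" for k
    by (auto simp: deriv_class_def)
  have "iter_deriv {0..<a} k ?h 0 = 0" for k
  proof (rule flat_at_0_zero[OF flat_at_0_iter_deriv[OF assms(1) diff flat]])
    have "continuous (at 0 within {0..<a}) (iter_deriv {0..<a} k ?h)"
      using has_vector_derivative_iter_deriv[OF diff, of k "Suc k" 0] assms(1)
      by (auto intro: has_vector_derivative_continuous)
    then have "(iter_deriv {0..<a} k ?h \<longlongrightarrow> iter_deriv {0..<a} k ?h 0) (at 0 within {0..<a})"
      by (simp add: continuous_within)
    \<comment> \<open>Near 0 the intervals [0, a) and [0, a/2] define the same one-sided limit, the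
      one in which flatness is phrased.\<close>
    then have "(iter_deriv {0..<a} k ?h \<longlongrightarrow> iter_deriv {0..<a} k ?h 0) (at 0 within {0..a / 2})"
      by (rule tendsto_within_subset) (use assms(1) in auto)
    then show "(iter_deriv {0..<a} k ?h \<longlongrightarrow> iter_deriv {0..<a} k ?h 0) (at_right 0)"
      using assms(1) by (simp add: at_within_Icc_at_right)
  qed
  then have "?h t = 0"
    using assms(1,2) h t unfolding quasi_analytic_def by force
  then show ?thesis by simp
qed

lemma flat_at_corner_flat_at_0:
  assumes "\<And>N. flat_at_corner 0 N g"
  shows "flat_at_0 (\<lambda>t. g (0, t))"
  unfolding flat_at_0_def
proof
  fix N
  from assms[of N] obtain e C where e: "0 < e"
    "\<And>x t. (x, t) \<in> square e \<Longrightarrow> norm (g (x, t)) \<le> C * t ^ N"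
    by (rule flat_at_corner_0E) auto
  then have "\<forall>\<^sub>F t in at_right 0. norm (g (0, t)) \<le> C * t ^ N"
    unfolding eventually_at_right_field by (auto simp: square_def intro!: exI[of _ e])
  then show "\<exists>C. \<forall>\<^sub>F t in at_right 0. norm (g (0, t)) \<le> C * t ^ N" ..
qed

lemma flat_at_0_entry:
  fixes F :: "real \<Rightarrow> complex^'n^'m"
  assumes "flat_at_0 F"
  shows "flat_at_0 (\<lambda>t. F t $ i $ j)"
  unfolding flat_at_0_def
proof
  fix N
  from assms obtain C where "\<forall>\<^sub>F t in at_right 0. norm (F t) \<le> C * t ^ N"
    unfolding flat_at_0_def by blast
  then have "\<forall>\<^sub>F t in at_right 0. norm (F t $ i $ j) \<le> C * t ^ N"
    by eventually_elim (meson Finite_Cartesian_Product.norm_nth_le order_trans)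
  then show "\<exists>C. \<forall>\<^sub>F t in at_right 0. norm (F t $ i $ j) \<le> C * t ^ N" ..
qed

lemma quasi_analytic_matrix_unique:
  fixes F G :: "real \<Rightarrow> complex^'n^'m"
  assumes "0 < a" "\<And>i j. quasi_analytic a (M i j)" "\<And>i j k. 0 < M i j k"
    and "F \<in> matrix_deriv_class a M" "G \<in> matrix_deriv_class a M"
    and "flat_at_0 (\<lambda>t. F t - G t)" "t \<in> {0..<a}"
  shows "F t = G t"
proof -
  have "F t $ i $ j = G t $ i $ j" for i j
  proof (rule quasi_analytic_unique[OF assms(1) assms(2)[of i j] _ _ _ _ assms(7)])
    show "flat_at_0 (\<lambda>t. F t $ i $ j - G t $ i $ j)"
      using flat_at_0_entry[OF assms(6), of i j] by simp
  qed (use assms(3-5) in \<open>auto simp: matrix_deriv_class_def less_imp_le\<close>)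
  then show ?thesis by (simp add: vec_eq_iff)
qed

section \<open>A Carleman estimate for the Schroedinger operator\<close>

lemma continuous_on_curried_compose:
  assumes "continuous_on (A \<times> T) (\<lambda>(x, t). f x t)" "continuous_on P u" "continuous_on P s"
    and "\<And>p. p \<in> P \<Longrightarrow> u p \<in> A" "\<And>p. p \<in> P \<Longrightarrow> s p \<in> T"
  shows "continuous_on P (\<lambda>p. f (u p) (s p))"
proof -
  have "continuous_on P (\<lambda>p. (\<lambda>(x, t). f x t) (u p, s p))"
    by (rule continuous_on_compose2[OF assms(1)]) (use assms in \<open>auto intro!: continuous_intros\<close>)
  then show ?thesis by simp
qed

lemma has_real_derivative_le_imp_diff_le:
  fixes f :: "real \<Rightarrow> real"
  assumes "p \<le> q" "{p..q} \<subseteq> S"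
    and f': "\<And>x. x \<in> {p..q} \<Longrightarrow> (f has_real_derivative f' x) (at x within S)"
      "\<And>x. x \<in> {p..q} \<Longrightarrow> f' x \<le> C"
  shows "f q - f p \<le> C * (q - p)"
proof -
  have "\<exists>x\<in>{p..q}. f q - f p = (*) (f' x) (q - p)"
  proof (rule mvt_very_simple[OF assms(1)])
    show "(f has_derivative (*) (f' x)) (at x within {p..q})" if "p \<le> x" "x \<le> q" for x
    proof -
      have "(f has_real_derivative f' x) (at x within {p..q})"
        using DERIV_subset[OF f'(1) assms(2)] that by simp
      then show ?thesis
        by (simp add: has_field_derivative_def)
    qed
  qed
  then obtain x where "x \<in> {p..q}" "f q - f p = f' x * (q - p)" by auto
  then show ?thesis
    using f'(2)[of x] assms(1) by (auto intro: mult_right_mono)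
qed

lemma difference_quotient_bound:
  fixes f :: "real \<Rightarrow> 'b::real_normed_vector"
  assumes "\<And>s. s \<in> S \<Longrightarrow> (f has_vector_derivative f' s) (at s within S)"
    and "closed_segment t s \<subseteq> S" "\<And>r. r \<in> closed_segment t s \<Longrightarrow> norm (f' r - f' t) \<le> e"
  shows "norm (f s - f t - (s - t) *\<^sub>R f' t) \<le> \<bar>s - t\<bar> * e"
proof -
  have "norm (f s - f t - (s - t) *\<^sub>R f' t) \<le> norm (s - t) * e"
  proof (rule vector_differentiable_bound_linearization[of "closed_segment t s"])
    show "(f has_vector_derivative f' r) (at r within closed_segment t s)" if "r \<in> closed_segment t s" for r
      using assms(1)[of r] assms(2) that has_vector_derivative_within_subset by blast
  qed (use assms(3) in auto)
  then show ?thesis by simp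
qed

text \<open>The model is multiplication by \<i> on complex matrices, seen as a real inner product
  space. The Carleman estimate uses nothing else about it and is therefore proved in an arbitrary
  Euclidean space.\<close>

locale skew_isometry =
  fixes J :: "'b::euclidean_space \<Rightarrow> 'b"
  assumes bounded_linear_J: "bounded_linear J"
    and J_skew: "J a \<bullet> b = - (a \<bullet> J b)"
    and norm_J: "norm (J a) = norm a"
begin

lemma linear_J: "linear J"
  using bounded_linear_J by (rule bounded_linear.linear)

lemma J_self [simp]: "J a \<bullet> a = 0" "a \<bullet> J a = 0"
  using J_skew[of a a] by (simp_all add: inner_commute)

lemma J_J [simp]: "J (J a) = - a"
proof -
  have iso: "J b \<bullet> J b = b \<bullet> b" for b
    using norm_J[of b] by (simp add: norm_eq_sqrt_inner)
  have "(J (J a) + a) \<bullet> (J (J a) + a) = 0"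
    using J_skew[of "J a" a] by (simp add: inner_add_left inner_add_right iso inner_commute)
  then show ?thesis
    by (simp add: eq_neg_iff_add_eq_0)
qed

lemma inner_J_J [simp]: "J a \<bullet> J b = a \<bullet> b"
  by (simp add: J_skew)

lemma continuous_on_J [continuous_intros]: "continuous_on S f \<Longrightarrow> continuous_on S (\<lambda>x. J (f x))"
  by (rule bounded_linear.continuous_on[OF bounded_linear_J])

text \<open>Subtracting the limit from a difference quotient leaves only the remainder
  \<open>a\<close>. It is used with k = 2 for symmetric and k = 1 for forward differences.\<close>

lemma J_inner_quotient:
  assumes "h \<noteq> 0" "u = a + (k * h) *\<^sub>R v"
  shows "(1 / h) * (J u \<bullet> y) - k * (J v \<bullet> y) = (1 / h) * (J a \<bullet> y)"
  using assms(1) unfolding assms(2)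
  by (simp add: linear_add[OF linear_J] linear_scale[OF linear_J] inner_add_left field_simps)

end

text \<open>
  The mixed derivative of \<open>z\<close> need not exist; the difference quotients in \<open>t\<close> take its place.
\<close>

lemma (in skew_isometry) has_real_derivative_skew_form:
  fixes z zx zt :: "real \<Rightarrow> real \<Rightarrow> 'b"
  assumes X: "0 \<le> X" and cd: "c \<le> d" and \<delta>: "0 < \<delta>"
    and zx: "\<And>x t. x \<in> {0..X} \<Longrightarrow> t \<in> {c - \<delta>..d + \<delta>} \<Longrightarrow>
      ((\<lambda>y. z y t) has_vector_derivative zx x t) (at x within {0..X})"
    and zt: "\<And>x t. x \<in> {0..X} \<Longrightarrow> t \<in> {c - \<delta>..d + \<delta>} \<Longrightarrow>
      (z x has_vector_derivative zt x t) (at t within {c - \<delta>..d + \<delta>})"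
    and cont_z: "continuous_on ({0..X} \<times> {c - \<delta>..d + \<delta>}) (\<lambda>(x, t). z x t)"
    and cont_zx: "continuous_on ({0..X} \<times> {c - \<delta>..d + \<delta>}) (\<lambda>(x, t). zx x t)"
    and cont_zt: "continuous_on ({0..X} \<times> {c - \<delta>..d + \<delta>}) (\<lambda>(x, t). zt x t)"
    and zero: "\<And>x t. x \<in> {0..X} \<Longrightarrow> t \<notin> {c<..<d} \<Longrightarrow> z x t = 0"
      "\<And>x t. x \<in> {0..X} \<Longrightarrow> t \<notin> {c<..<d} \<Longrightarrow> zx x t = 0"
    and x0: "x0 \<in> {0..X}"
  shows "((\<lambda>x. integral {c..d} (\<lambda>t. J (zt x t) \<bullet> z x t)) has_real_derivative
      integral {c..d} (\<lambda>t. 2 * (J (zt x0 t) \<bullet> zx x0 t))) (at x0 within {0..X})"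
proof -
  let ?I = "{c - \<delta>..d + \<delta>}"
  note cz = continuous_on_curried_compose[OF cont_z]
  note czx = continuous_on_curried_compose[OF cont_zx]
  note czt = continuous_on_curried_compose[OF cont_zt]
  have compact: "compact ({0..X} \<times> ?I)" by (intro compact_Times compact_Icc)
  have "bounded ((\<lambda>(x, t). z x t) ` ({0..X} \<times> ?I))" "bounded ((\<lambda>(x, t). zx x t) ` ({0..X} \<times> ?I))"
    using compact cont_z cont_zx by (auto intro!: compact_imp_bounded compact_continuous_image)
  then obtain M1 M2 where M12: "\<And>x t. x \<in> {0..X} \<Longrightarrow> t \<in> ?I \<Longrightarrow> norm (z x t) \<le> M1"
     "\<And>x t. x \<in> {0..X} \<Longrightarrow> t \<in> ?I \<Longrightarrow> norm (zx x t) \<le> M2"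
    unfolding bounded_iff by fastforce
  define M where "M = max 1 (max M1 M2)"
  have M: "norm (z x t) \<le> M" "norm (zx x t) \<le> M" if "x \<in> {0..X}" "t \<in> ?I" for x t
    using M12[OF that] by (auto simp: M_def)
  have M0: "0 < M" by (simp add: M_def)
  \<comment> \<open>Time steps that do not exceed the margin \<delta> on either side of
    [c, d].\<close>
  define h where "h n = \<delta> / real (Suc n)" for n
  have h: "0 < h n" "h n \<le> \<delta>" for n
    using \<delta> by (auto simp: h_def field_simps)
  have h_lim: "h \<longlonglongrightarrow> 0"
    unfolding h_def by (rule LIMSEQ_Suc[OF lim_const_over_n])
  \<comment> \<open>A forward difference quotient in disguise: the missing term
    \<open>J (z x t) \<bullet> z x t\<close> is 0.\<close>
  define f where "f n x = (1 / h n) * integral {c..d} (\<lambda>t. J (z x (t + h n)) \<bullet> z x t)" for n x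
  define g where "g x = integral {c..d} (\<lambda>t. J (zt x t) \<bullet> z x t)" for x
  define g' where "g' x = integral {c..d} (\<lambda>t. 2 * (J (zt x t) \<bullet> zx x t))" for x
  define f' where
    "f' n x = integral {c..d} (\<lambda>t. (1 / h n) * (J (z x (t + h n) - z x (t - h n)) \<bullet> zx x t))" for n x
  have in_I: "t \<in> ?I" "t + h n \<in> ?I" "t - h n \<in> ?I" if "t \<in> {c..d}" for t n
    using that h[of n] by auto
  \<comment> \<open>The x-derivative of \<open>f n\<close> contains \<open>zx\<close> at the shifted
    time, whose quotient need have no limit without a mixed derivative. Translating the time
    integral and using the skewness of \<open>J\<close> moves the shift onto \<open>z\<close>; the
    pieces of length \<open>h n\<close> at the two ends contribute nothing, since \<open>z\<close>
    or \<open>zx\<close> vanishes there.\<close>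
  have shift: "integral {c..d} (\<lambda>t. J (zx x (t + h n)) \<bullet> z x t)
      = - integral {c..d} (\<lambda>t. J (z x (t - h n)) \<bullet> zx x t)" if x: "x \<in> {0..X}" for n x
  proof -
    define F where "F t = J (z x (t - h n)) \<bullet> zx x t" for t
    have cont: "continuous_on {c..d + h n} F"
      unfolding F_def using x h[of n]
      by (intro continuous_intros cz czx) auto
    then have int: "F integrable_on {c..d + h n}"
      by (rule integrable_continuous_real)
    have split: "integral {c..c + h n} F + integral {c + h n..d + h n} F
       = integral {c..d} F + integral {d..d + h n} F"
      using cd h[of n] int by (simp add: Henstock_Kurzweil_Integration.integral_combine)
    have "integral {c..c + h n} F = integral {c..c + h n} (\<lambda>t. 0)"
      by (rule integral_cong) (use x in \<open>auto simp: F_def zero linear_0[OF linear_J]\<close>)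
    moreover have "integral {d..d + h n} F = integral {d..d + h n} (\<lambda>t. 0)"
      by (rule integral_cong) (use x in \<open>auto simp: F_def zero\<close>)
    ultimately have eq: "integral {c + h n..d + h n} F = integral {c..d} F"
      using split by simp
    have "(F has_integral integral {c + h n..d + h n} F) (cbox (c + h n) (d + h n))"
      using int cd h[of n] unfolding box_real
      by (intro integrable_integral integrable_subinterval_real[OF int]) auto
    then have "((F \<circ> (+) (h n)) has_integral integral {c + h n..d + h n} F) (cbox c d)"
      by (subst has_integral_shift_cbox_iff)
    then have "integral {c..d} (\<lambda>t. F (t + h n)) = integral {c..d} F"
      unfolding eq by (simp add: o_def add.commute integral_unique)
    moreover have "J (zx x (t + h n)) \<bullet> z x t = - F (t + h n)" for t
      using J_skew[of "zx x (t + h n)" "z x t"] by (simp add: F_def inner_commute)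
    ultimately show ?thesis
      by (simp add: F_def[abs_def])
  qed
  have f_deriv: "(f n has_derivative (\<lambda>r. r * f' n x)) (at x within {0..X})" if x: "x \<in> {0..X}" for n x
  proof -
    have "((\<lambda>x. integral (cbox c d) (\<lambda>t. J (z x (t + h n)) \<bullet> z x t)) has_vector_derivative
       integral (cbox c d) (\<lambda>t. J (z x (t + h n)) \<bullet> zx x t + J (zx x (t + h n)) \<bullet> z x t)) (at x within {0..X})"
    proof (rule leibniz_rule_vector_derivative)
      show "((\<lambda>x. J (z x (t + h n)) \<bullet> z x t) has_vector_derivative
          J (z x (t + h n)) \<bullet> zx x t + J (zx x (t + h n)) \<bullet> z x t) (at x within {0..X})"
        if "x \<in> {0..X}" "t \<in> cbox c d" for x t
        using that in_I[of t]
        by (intro bounded_bilinear.has_vector_derivative[OF bounded_bilinear_inner]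
            bounded_linear.has_vector_derivative[OF bounded_linear_J] zx) auto
      show "(\<lambda>t. J (z x (t + h n)) \<bullet> z x t) integrable_on cbox c d" if "x \<in> {0..X}" for x
        unfolding box_real using that in_I
        by (intro integrable_continuous_real continuous_intros cz) auto
      show "continuous_on ({0..X} \<times> cbox c d)
          (\<lambda>(x, t). J (z x (t + h n)) \<bullet> zx x t + J (zx x (t + h n)) \<bullet> z x t)"
        unfolding split_def using in_I
        by (intro continuous_intros cz czx) auto
    qed (use x in auto)
    moreover have "integral (cbox c d) (\<lambda>t. J (z x (t + h n)) \<bullet> zx x t + J (zx x (t + h n)) \<bullet> z x t)
       = h n * f' n x"
    proof -
      have i1: "(\<lambda>t. J (z x (t + h n)) \<bullet> zx x t) integrable_on {c..d}"
        "(\<lambda>t. J (zx x (t + h n)) \<bullet> z x t) integrable_on {c..d}"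
        "(\<lambda>t. J (z x (t - h n)) \<bullet> zx x t) integrable_on {c..d}"
        using x in_I by (auto intro!: integrable_continuous_real continuous_intros cz czx)
      have "integral (cbox c d) (\<lambda>t. J (z x (t + h n)) \<bullet> zx x t + J (zx x (t + h n)) \<bullet> z x t)
         = integral {c..d} (\<lambda>t. J (z x (t + h n)) \<bullet> zx x t - J (z x (t - h n)) \<bullet> zx x t)"
        unfolding box_real using i1 by (simp add: integral_add integral_diff shift[OF x])
      also have "\<dots> = h n * f' n x"
        using h[of n] by (simp add: f'_def linear_diff[OF linear_J] inner_diff_left)
      finally show ?thesis .
    qed
    ultimately have "((\<lambda>x. integral {c..d} (\<lambda>t. J (z x (t + h n)) \<bullet> z x t)) has_real_derivative h n * f' n x)
        (at x within {0..X})"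
      by (simp add: has_real_derivative_iff_has_vector_derivative)
    from DERIV_cmult[OF this, of "1 / h n"]
    have "(f n has_real_derivative f' n x) (at x within {0..X})"
      using h[of n] by (simp add: f_def[abs_def])
    then show ?thesis
      unfolding has_field_derivative_def by (simp add: mult_commute_abs)
  qed
  \<comment> \<open>Uniformity in x is what exchanging limit and x-derivative requires; it comes
    from the uniform continuity of \<open>zt\<close>.\<close>
  have ev_small: "\<forall>\<^sub>F n in sequentially. \<forall>x\<in>{0..X}. \<forall>t\<in>{c..d}.
      norm (z x (t + h n) - z x t - h n *\<^sub>R zt x t) \<le> h n * e \<and>
      norm (z x (t - h n) - z x t + h n *\<^sub>R zt x t) \<le> h n * e" if "0 < e" for e
  proof -
    have "uniformly_continuous_on ({0..X} \<times> ?I) (\<lambda>(x, t). zt x t)"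
      by (rule compact_uniformly_continuous[OF cont_zt compact])
    with \<open>0 < e\<close> obtain r where r: "0 < r" "\<And>p q. p \<in> {0..X} \<times> ?I \<Longrightarrow> q \<in> {0..X} \<times> ?I \<Longrightarrow>
        dist q p < r \<Longrightarrow> dist ((\<lambda>(x, t). zt x t) q) ((\<lambda>(x, t). zt x t) p) < e"
      unfolding uniformly_continuous_on_def by metis
    have zt_close: "norm (zt x s - zt x t) \<le> e"
      if "x \<in> {0..X}" "t \<in> ?I" "s \<in> ?I" "\<bar>s - t\<bar> < r" for x s t
      using r(2)[of "(x, t)" "(x, s)"] that by (simp add: dist_norm norm_Pair)
    have "\<forall>\<^sub>F n in sequentially. h n < r"
      using h_lim r(1) by (rule order_tendstoD(2))
    then show ?thesis
    proof eventually_elim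
      case (elim n)
      show ?case
      proof (intro ballI)
        fix x t assume x: "x \<in> {0..X}" and t: "t \<in> {c..d}"
        have "norm (z x (t + h n) - z x t - (t + h n - t) *\<^sub>R zt x t) \<le> \<bar>t + h n - t\<bar> * e"
          by (rule difference_quotient_bound[OF zt[OF x]])
            (use x t h[of n] elim in \<open>auto simp: closed_segment_eq_real_ivl intro!: zt_close\<close>)
        moreover have "norm (z x (t - h n) - z x t - (t - h n - t) *\<^sub>R zt x t) \<le> \<bar>t - h n - t\<bar> * e"
          by (rule difference_quotient_bound[OF zt[OF x]])
            (use x t h[of n] elim in \<open>auto simp: closed_segment_eq_real_ivl intro!: zt_close\<close>)
        ultimately show "norm (z x (t + h n) - z x t - h n *\<^sub>R zt x t) \<le> h n * e \<and>
            norm (z x (t - h n) - z x t + h n *\<^sub>R zt x t) \<le> h n * e"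
          using h[of n] by simp
      qed
    qed
  qed
  have f'_close: "\<forall>\<^sub>F n in sequentially. \<forall>x\<in>{0..X}. \<bar>f' n x - g' x\<bar> \<le> e" if "0 < e" for e
  proof -
    \<comment> \<open>The summand 1 keeps the denominator positive when c = d.\<close>
    define e' where "e' = e / (2 * M * (d - c + 1))"
    have e': "0 < e'"
      using that M0 cd by (simp add: e'_def)
    from ev_small[OF this] show ?thesis
    proof eventually_elim
      case (elim n)
      show ?case
      proof
        fix x assume x: "x \<in> {0..X}"
        have i: "(\<lambda>t. (1 / h n) * (J (z x (t + h n) - z x (t - h n)) \<bullet> zx x t)) integrable_on {c..d}"
          "(\<lambda>t. 2 * (J (zt x t) \<bullet> zx x t)) integrable_on {c..d}"
          using x in_I h[of n] by (auto intro!: integrable_continuous_real continuous_intros cz czx czt)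
        have "norm (f' n x - g' x) = norm (integral {c..d} (\<lambda>t.
            (1 / h n) * (J (z x (t + h n) - z x (t - h n)) \<bullet> zx x t) - 2 * (J (zt x t) \<bullet> zx x t)))"
          unfolding f'_def g'_def integral_diff[OF i] ..
        also have "\<dots> \<le> (2 * e' * M) * (d - c)"
        proof (rule integral_bound)
          show "continuous_on {c..d} (\<lambda>t.
            (1 / h n) * (J (z x (t + h n) - z x (t - h n)) \<bullet> zx x t) - 2 * (J (zt x t) \<bullet> zx x t))"
            using x in_I by (intro continuous_intros cz czx czt) auto
          fix t assume t: "t \<in> {c..d}"
          let ?a = "z x (t + h n) - z x t - h n *\<^sub>R zt x t"
          let ?b = "z x (t - h n) - z x t + h n *\<^sub>R zt x t"
          have ab: "norm (?a - ?b) \<le> h n * e' + h n * e'"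
            using elim x t by (intro order_trans[OF norm_triangle_ineq4 add_mono]) blast+
          have "z x (t + h n) - z x (t - h n) = (?a - ?b) + (2 * h n) *\<^sub>R zt x t"
            by (simp only: mult_2 scaleR_add_left) simp
          then have "(1 / h n) * (J (z x (t + h n) - z x (t - h n)) \<bullet> zx x t) - 2 * (J (zt x t) \<bullet> zx x t)
              = (1 / h n) * (J (?a - ?b) \<bullet> zx x t)"
            using h(1)[of n] by (intro J_inner_quotient) auto
          also have "norm \<dots> \<le> (1 / h n) * (norm (?a - ?b) * norm (zx x t))"
            using h[of n] Cauchy_Schwarz_ineq2[of "J (?a - ?b)" "zx x t"]
            by (simp add: abs_mult norm_J divide_right_mono)
          also have "\<dots> \<le> (1 / h n) * ((h n * e' + h n * e') * M)"
            by (intro mult_left_mono mult_mono ab M x in_I(1)[OF t])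
              (use h[of n] e' in \<open>simp_all add: less_imp_le\<close>)
          also have "\<dots> = 2 * e' * M"
            using h[of n] by (simp add: field_simps)
          finally show "norm ((1 / h n) * (J (z x (t + h n) - z x (t - h n)) \<bullet> zx x t)
              - 2 * (J (zt x t) \<bullet> zx x t)) \<le> 2 * e' * M" .
        qed (rule cd)
        also have "\<dots> \<le> (2 * e' * M) * (d - c + 1)"
          using e' M0 by (intro mult_left_mono) auto
        also have "\<dots> = e"
          using M0 cd by (simp add: e'_def)
        finally show "\<bar>f' n x - g' x\<bar> \<le> e" by simp
      qed
    qed
  qed
  have f_lim: "(\<lambda>n. f n x) \<longlonglongrightarrow> g x" if x: "x \<in> {0..X}" for x
  proof (rule metric_LIMSEQ_I)
    fix e :: real assume e: "0 < e"
    define e' where "e' = e / (2 * M * (d - c + 1))"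
    have e': "0 < e'"
      using e M0 cd by (simp add: e'_def)
    have "\<forall>\<^sub>F n in sequentially. dist (f n x) (g x) < e"
      using ev_small[OF e']
    proof eventually_elim
      case (elim n)
      have i: "(\<lambda>t. (1 / h n) * (J (z x (t + h n)) \<bullet> z x t)) integrable_on {c..d}"
        "(\<lambda>t. J (zt x t) \<bullet> z x t) integrable_on {c..d}"
        using x in_I h[of n] by (auto intro!: integrable_continuous_real continuous_intros cz czx czt)
      have "norm (f n x - g x) = norm (integral {c..d} (\<lambda>t.
          (1 / h n) * (J (z x (t + h n)) \<bullet> z x t) - J (zt x t) \<bullet> z x t))"
        unfolding f_def g_def integral_diff[OF i] by simp
      also have "\<dots> \<le> (e' * M) * (d - c)"
      proof (rule integral_bound)
        show "continuous_on {c..d} (\<lambda>t. (1 / h n) * (J (z x (t + h n)) \<bullet> z x t) - J (zt x t) \<bullet> z x t)"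
          using x in_I by (intro continuous_intros cz czx czt) auto
        fix t assume t: "t \<in> {c..d}"
        let ?a = "z x (t + h n) - z x t - h n *\<^sub>R zt x t"
        have a: "norm ?a \<le> h n * e'"
          using elim x t by blast
        have "z x (t + h n) = (?a + z x t) + (1 * h n) *\<^sub>R zt x t"
          by simp
        from J_inner_quotient[OF _ this, of "z x t"] h(1)[of n]
        have "(1 / h n) * (J (z x (t + h n)) \<bullet> z x t) - J (zt x t) \<bullet> z x t
            = (1 / h n) * (J (?a + z x t) \<bullet> z x t)"
          by simp
        also have "\<dots> = (1 / h n) * (J ?a \<bullet> z x t)"
          by (subst linear_add[OF linear_J]) (simp only: inner_add_left J_self add_0_right)
        also have "norm \<dots> \<le> (1 / h n) * (norm ?a * norm (z x t))"
          using h[of n] Cauchy_Schwarz_ineq2[of "J ?a" "z x t"]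
          by (simp add: abs_mult norm_J divide_right_mono)
        also have "\<dots> \<le> (1 / h n) * ((h n * e') * M)"
          by (intro mult_left_mono mult_mono a M x in_I(1)[OF t])
            (use h[of n] e' in \<open>simp_all add: less_imp_le\<close>)
        also have "\<dots> = e' * M"
          using h[of n] by (simp add: field_simps)
        finally show "norm ((1 / h n) * (J (z x (t + h n)) \<bullet> z x t) - J (zt x t) \<bullet> z x t) \<le> e' * M" .
      qed (rule cd)
      also have "\<dots> < (2 * e' * M) * (d - c + 1)"
        using mult_pos_pos[OF e' M0] mult_nonneg_nonneg[OF less_imp_le[OF mult_pos_pos[OF e' M0]], of "d - c"] cd
        by (simp add: algebra_simps)
      also have "\<dots> = e"
        using M0 cd by (simp add: e'_def)
      finally show ?case by (simp add: dist_norm)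
    qed
    then show "\<exists>no. \<forall>n\<ge>no. dist (f n x) (g x) < e"
      unfolding eventually_sequentially .
  qed
  \<comment> \<open>Pointwise convergence of \<open>f n\<close> and uniform convergence of
    \<open>f' n\<close> allow the limit to be differentiated.\<close>
  have "\<exists>l. \<forall>x\<in>{0..X}. (\<lambda>n. f n x) \<longlonglongrightarrow> l x \<and> (l has_derivative (\<lambda>r. r * g' x)) (at x within {0..X})"
  proof (rule has_derivative_sequence[OF _ f_deriv _ x0 f_lim[OF x0]])
    fix e :: real assume "0 < e"
    from f'_close[OF this]
    show "\<forall>\<^sub>F n in sequentially. \<forall>x\<in>{0..X}. \<forall>r. norm (r * f' n x - r * g' x) \<le> e * norm r"
    proof eventually_elim
      case (elim n)
      show ?case
      proof (intro ballI allI)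
        fix x r :: real assume "x \<in> {0..X}"
        with elim have "\<bar>r\<bar> * \<bar>f' n x - g' x\<bar> \<le> \<bar>r\<bar> * e"
          by (intro mult_left_mono) auto
        then show "norm (r * f' n x - r * g' x) \<le> e * norm r"
          by (simp add: right_diff_distrib[symmetric] abs_mult mult.commute)
      qed
    qed
  qed auto
  then obtain l where l: "\<And>x. x \<in> {0..X} \<Longrightarrow> (\<lambda>n. f n x) \<longlonglongrightarrow> l x"
    "\<And>x. x \<in> {0..X} \<Longrightarrow> (l has_derivative (\<lambda>r. r * g' x)) (at x within {0..X})" by metis
  have "(g has_derivative (\<lambda>r. r * g' x0)) (at x0 within {0..X})"
    by (rule has_derivative_transform[OF x0 _ l(2)[OF x0]]) (rule LIMSEQ_unique[OF f_lim l(1)])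
  then have "(g has_real_derivative g' x0) (at x0 within {0..X})"
    unfolding has_field_derivative_def by (simp add: mult_commute_abs)
  then show ?thesis
    unfolding g_def[abs_def] g'_def .
qed

text \<open>
  \<open>G = S + A\<close> with the formally self-adjoint part \<open>S = 2Jz\<^sub>t + z\<^sub>x\<^sub>x + 4\<tau>\<^sup>2(R - x)\<^sup>2z\<close> and the formally
  skew-adjoint part \<open>A = 4\<tau>(R - x)z\<^sub>x - 2\<tau>z + 4\<tau>\<beta>(t - t\<^sub>0)Jz\<close>. The energy is chosen such that its
  derivative is the integral of \<open>S \<bullet> A \<le> \<bar>G\<bar>\<^sup>2/4\<close> minus the positive commutator terms.
\<close>

lemma (in skew_isometry) carleman_energy_derivative:
  fixes z zx zt zxx G :: "real \<Rightarrow> real \<Rightarrow> 'b" and R \<tau> \<beta> t0 c d :: real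
  defines "Q \<equiv> \<lambda>x. integral {c..d} (\<lambda>t. 2 * \<tau> * (R - x) * (zx x t \<bullet> zx x t) - 2 * \<tau> * (zx x t \<bullet> z x t)
      + 4 * \<tau> * \<beta> * (t - t0) * (zx x t \<bullet> J (z x t)) + 8 * \<tau>^3 * (R - x)^3 * (z x t \<bullet> z x t))
      + 4 * \<tau> * (R - x) * integral {c..d} (\<lambda>t. J (zt x t) \<bullet> z x t)"
  assumes X: "0 \<le> X" and cd: "c \<le> d" and \<delta>: "0 < \<delta>" and \<tau>: "0 \<le> \<tau>"
    and zx: "\<And>x t. x \<in> {0..X} \<Longrightarrow> t \<in> {c - \<delta>..d + \<delta>} \<Longrightarrow>
      ((\<lambda>y. z y t) has_vector_derivative zx x t) (at x within {0..X})"
    and zxx: "\<And>x t. x \<in> {0..X} \<Longrightarrow> t \<in> {c - \<delta>..d + \<delta>} \<Longrightarrow>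
      ((\<lambda>y. zx y t) has_vector_derivative zxx x t) (at x within {0..X})"
    and zt: "\<And>x t. x \<in> {0..X} \<Longrightarrow> t \<in> {c - \<delta>..d + \<delta>} \<Longrightarrow>
      (z x has_vector_derivative zt x t) (at t within {c - \<delta>..d + \<delta>})"
    and cont_z: "continuous_on ({0..X} \<times> {c - \<delta>..d + \<delta>}) (\<lambda>(x, t). z x t)"
    and cont_zx: "continuous_on ({0..X} \<times> {c - \<delta>..d + \<delta>}) (\<lambda>(x, t). zx x t)"
    and cont_zxx: "continuous_on ({0..X} \<times> {c - \<delta>..d + \<delta>}) (\<lambda>(x, t). zxx x t)"
    and cont_zt: "continuous_on ({0..X} \<times> {c - \<delta>..d + \<delta>}) (\<lambda>(x, t). zt x t)"
    and zero: "\<And>x t. x \<in> {0..X} \<Longrightarrow> t \<notin> {c<..<d} \<Longrightarrow> z x t = 0"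
      "\<And>x t. x \<in> {0..X} \<Longrightarrow> t \<notin> {c<..<d} \<Longrightarrow> zx x t = 0"
    and G: "\<And>x t. x \<in> {0..X} \<Longrightarrow> t \<in> {c..d} \<Longrightarrow> G x t =
      (2 *\<^sub>R J (zt x t) + zxx x t + (4 * \<tau>^2 * (R - x)^2) *\<^sub>R z x t) +
      ((4 * \<tau> * (R - x)) *\<^sub>R zx x t - (2 * \<tau>) *\<^sub>R z x t + (4 * \<tau> * \<beta> * (t - t0)) *\<^sub>R J (z x t))"
    and x0: "x0 \<in> {0..X}"
  shows "\<exists>D. (Q has_real_derivative D) (at x0 within {0..X}) \<and>
    D \<le> integral {c..d} (\<lambda>t. (norm (G x0 t))^2 / 4 + (4 * \<tau> * \<beta> - 16 * \<tau>^3 * (R - x0)^2) * (z x0 t \<bullet> z x0 t))"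
proof -
  note cz = continuous_on_curried_compose[OF cont_z]
  note czx = continuous_on_curried_compose[OF cont_zx]
  note czxx = continuous_on_curried_compose[OF cont_zxx]
  note czt = continuous_on_curried_compose[OF cont_zt]
  have in_I: "t \<in> {c - \<delta>..d + \<delta>}" if "t \<in> {c..d}" for t
    using that \<delta> by auto
  define q where "q x t = 2 * \<tau> * (R - x) * (zx x t \<bullet> zx x t) - 2 * \<tau> * (zx x t \<bullet> z x t)
      + 4 * \<tau> * \<beta> * (t - t0) * (zx x t \<bullet> J (z x t)) + 8 * \<tau>^3 * (R - x)^3 * (z x t \<bullet> z x t)" for x t
  define qx where "qx x t = - 4 * \<tau> * (zx x t \<bullet> zx x t) + 4 * \<tau> * (R - x) * (zx x t \<bullet> zxx x t)
      - 2 * \<tau> * (zxx x t \<bullet> z x t) + 4 * \<tau> * \<beta> * (t - t0) * (zxx x t \<bullet> J (z x t))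
      - 24 * \<tau>^3 * (R - x)^2 * (z x t \<bullet> z x t) + 16 * \<tau>^3 * (R - x)^3 * (z x t \<bullet> zx x t)" for x t
  \<comment> \<open>The form with \<open>zt\<close> is kept apart from \<open>q\<close>, which may
    be differentiated in x under the integral sign.\<close>
  define B where "B x = integral {c..d} (\<lambda>t. J (zt x t) \<bullet> z x t)" for x
  define B' where "B' = integral {c..d} (\<lambda>t. 2 * (J (zt x0 t) \<bullet> zx x0 t))"
  have q_deriv: "((\<lambda>x. q x t) has_vector_derivative qx x t) (at x within {0..X})"
    if xt: "x \<in> {0..X}" "t \<in> cbox c d" for x t
  proof -
    have t: "t \<in> {c - \<delta>..d + \<delta>}" using in_I xt by auto
    note inner = bounded_bilinear.has_vector_derivative[OF bounded_bilinear_inner]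
    note J = bounded_linear.has_vector_derivative[OF bounded_linear_J]
    have D1: "((\<lambda>x. zx x t \<bullet> zx x t) has_real_derivative 2 * (zx x t \<bullet> zxx x t)) (at x within {0..X})"
      using inner[OF zxx[OF xt(1) t] zxx[OF xt(1) t]]
      by (simp add: has_real_derivative_iff_has_vector_derivative inner_commute)
    have D2: "((\<lambda>x. zx x t \<bullet> z x t) has_real_derivative zx x t \<bullet> zx x t + zxx x t \<bullet> z x t) (at x within {0..X})"
      using inner[OF zxx[OF xt(1) t] zx[OF xt(1) t]]
      by (simp add: has_real_derivative_iff_has_vector_derivative)
    have D3: "((\<lambda>x. zx x t \<bullet> J (z x t)) has_real_derivative zxx x t \<bullet> J (z x t)) (at x within {0..X})"
      using inner[OF zxx[OF xt(1) t] J[OF zx[OF xt(1) t]]]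
      by (simp add: has_real_derivative_iff_has_vector_derivative)
    have D4: "((\<lambda>x. z x t \<bullet> z x t) has_real_derivative 2 * (z x t \<bullet> zx x t)) (at x within {0..X})"
      using inner[OF zx[OF xt(1) t] zx[OF xt(1) t]]
      by (simp add: has_real_derivative_iff_has_vector_derivative inner_commute)
    have "((\<lambda>x. q x t) has_real_derivative qx x t) (at x within {0..X})"
      unfolding q_def qx_def
      by (rule D1 D2 D3 D4 refl derivative_eq_intros)+ (simp add: algebra_simps)
    then show ?thesis
      by (simp add: has_real_derivative_iff_has_vector_derivative)
  qed
  have "((\<lambda>x. integral (cbox c d) (q x)) has_vector_derivative integral (cbox c d) (qx x0)) (at x0 within {0..X})"
  proof (rule leibniz_rule_vector_derivative[OF q_deriv])
    show "q x integrable_on cbox c d" if "x \<in> {0..X}" for x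
      unfolding box_real q_def using that in_I
      by (intro integrable_continuous_real continuous_intros cz czx) auto
    show "continuous_on ({0..X} \<times> cbox c d) (\<lambda>(x, t). qx x t)"
      unfolding split_def qx_def using in_I
      by (intro continuous_intros cz czx czxx) auto
  qed (use x0 in auto)
  then have q_int: "((\<lambda>x. integral {c..d} (q x)) has_real_derivative integral {c..d} (qx x0)) (at x0 within {0..X})"
    by (simp add: has_real_derivative_iff_has_vector_derivative)
  have B_deriv: "(B has_real_derivative B') (at x0 within {0..X})"
    using has_real_derivative_skew_form[OF X cd \<delta> zx zt cont_z cont_zx cont_zt zero x0]
    unfolding B_def[abs_def] B'_def .
  have "((\<lambda>x. integral {c..d} (q x) + 4 * \<tau> * (R - x) * B x) has_real_derivative
      integral {c..d} (qx x0) + (4 * \<tau> * (R - x0) * B' - 4 * \<tau> * B x0)) (at x0 within {0..X})"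
    by (rule q_int B_deriv refl derivative_eq_intros)+ (simp add: algebra_simps)
  moreover have "Q = (\<lambda>x. integral {c..d} (q x) + 4 * \<tau> * (R - x) * B x)"
    unfolding Q_def q_def B_def ..
  ultimately have Q_deriv: "(Q has_real_derivative
      integral {c..d} (qx x0) + (4 * \<tau> * (R - x0) * B' - 4 * \<tau> * B x0)) (at x0 within {0..X})"
    by simp
  \<comment> \<open>The integral of the time derivative of (t - t0) |z|^2. This zero is added to the
    derivative of \<open>Q\<close>: it supplies the product of the \<open>zt\<close> term of S with
    the \<beta> term of A, at the price of 4 \<tau> \<beta> |z|^2, which has the unfavourable
    sign.\<close>
  have parts: "integral {c..d} (\<lambda>t. z x0 t \<bullet> z x0 t + 2 * (t - t0) * (zt x0 t \<bullet> z x0 t)) = 0"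
  proof -
    have "((\<lambda>t. z x0 t \<bullet> z x0 t + 2 * (t - t0) * (zt x0 t \<bullet> z x0 t)) has_integral
        (d - t0) * (z x0 d \<bullet> z x0 d) - (c - t0) * (z x0 c \<bullet> z x0 c)) {c..d}"
    proof (rule fundamental_theorem_of_calculus[OF cd])
      fix t assume t: "t \<in> {c..d}"
      have d: "(z x0 has_vector_derivative zt x0 t) (at t within {c..d})"
        by (rule has_vector_derivative_within_subset[OF zt[OF x0 in_I[OF t]]]) (use \<delta> in auto)
      have D: "((\<lambda>t. z x0 t \<bullet> z x0 t) has_real_derivative 2 * (zt x0 t \<bullet> z x0 t)) (at t within {c..d})"
        using bounded_bilinear.has_vector_derivative[OF bounded_bilinear_inner d d]
        by (simp add: has_real_derivative_iff_has_vector_derivative inner_commute)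
      have "((\<lambda>t. (t - t0) * (z x0 t \<bullet> z x0 t)) has_real_derivative
          z x0 t \<bullet> z x0 t + 2 * (t - t0) * (zt x0 t \<bullet> z x0 t)) (at t within {c..d})"
        by (rule D refl derivative_eq_intros)+ (simp add: algebra_simps)
      then show "((\<lambda>t. (t - t0) * (z x0 t \<bullet> z x0 t)) has_vector_derivative
          z x0 t \<bullet> z x0 t + 2 * (t - t0) * (zt x0 t \<bullet> z x0 t)) (at t within {c..d})"
        by (simp add: has_real_derivative_iff_has_vector_derivative)
    qed
    then show ?thesis
      using zero(1)[OF x0, of c] zero(1)[OF x0, of d] by (simp add: integral_unique)
  qed
  define E where "E t = qx x0 t + (4 * \<tau> * (R - x0) * (2 * (J (zt x0 t) \<bullet> zx x0 t)) - 4 * \<tau> * (J (zt x0 t) \<bullet> z x0 t))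
     + 4 * \<tau> * \<beta> * (z x0 t \<bullet> z x0 t + 2 * (t - t0) * (zt x0 t \<bullet> z x0 t))" for t
  have cont: "continuous_on {c..d} (z x0)" "continuous_on {c..d} (zx x0)" "continuous_on {c..d} (zxx x0)"
    "continuous_on {c..d} (zt x0)"
    using x0 in_I by (auto intro!: cz[of _ "\<lambda>_. x0" "\<lambda>t. t"] czx[of _ "\<lambda>_. x0" "\<lambda>t. t"]
       czxx[of _ "\<lambda>_. x0" "\<lambda>t. t"] czt[of _ "\<lambda>_. x0" "\<lambda>t. t"] continuous_intros)
  have int: "qx x0 integrable_on {c..d}" "(\<lambda>t. 2 * (J (zt x0 t) \<bullet> zx x0 t)) integrable_on {c..d}"
    "(\<lambda>t. J (zt x0 t) \<bullet> z x0 t) integrable_on {c..d}"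
    "(\<lambda>t. z x0 t \<bullet> z x0 t + 2 * (t - t0) * (zt x0 t \<bullet> z x0 t)) integrable_on {c..d}"
    unfolding qx_def by (intro integrable_continuous_real continuous_intros cont)+
  have "integral {c..d} (qx x0) + (4 * \<tau> * (R - x0) * B' - 4 * \<tau> * B x0) = integral {c..d} E"
  proof -
    note hi = int[THEN integrable_integral]
    have "(E has_integral (integral {c..d} (qx x0) + (4 * \<tau> * (R - x0) * B' - 4 * \<tau> * B x0) + 4 * \<tau> * \<beta> * 0)) {c..d}"
      unfolding E_def B'_def B_def parts[symmetric]
      by (intro has_integral_add has_integral_diff has_integral_mult_right hi)
    then show ?thesis by (simp add: integral_unique)
  qed
  also have "\<dots> \<le> integral {c..d} (\<lambda>t. (norm (G x0 t))^2 / 4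
      + (4 * \<tau> * \<beta> - 16 * \<tau>^3 * (R - x0)^2) * (z x0 t \<bullet> z x0 t))"
  proof (rule integral_le)
    show "E integrable_on {c..d}"
      unfolding E_def qx_def by (intro integrable_continuous_real continuous_intros cont)
    have "continuous_on {c..d} (\<lambda>t. (2 *\<^sub>R J (zt x0 t) + zxx x0 t + (4 * \<tau>^2 * (R - x0)^2) *\<^sub>R z x0 t) +
      ((4 * \<tau> * (R - x0)) *\<^sub>R zx x0 t - (2 * \<tau>) *\<^sub>R z x0 t + (4 * \<tau> * \<beta> * (t - t0)) *\<^sub>R J (z x0 t)))"
      by (intro continuous_intros cont)
    then have "continuous_on {c..d} (G x0)"
      by (rule continuous_on_eq) (use G x0 in auto)
    then show "(\<lambda>t. (norm (G x0 t))^2 / 4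
      + (4 * \<tau> * \<beta> - 16 * \<tau>^3 * (R - x0)^2) * (z x0 t \<bullet> z x0 t)) integrable_on {c..d}"
      by (intro integrable_continuous_real continuous_intros cont) simp_all
    fix t assume t: "t \<in> {c..d}"
    define S where "S = 2 *\<^sub>R J (zt x0 t) + zxx x0 t + (4 * \<tau>^2 * (R - x0)^2) *\<^sub>R z x0 t"
    define A where "A = (4 * \<tau> * (R - x0)) *\<^sub>R zx x0 t - (2 * \<tau>) *\<^sub>R z x0 t + (4 * \<tau> * \<beta> * (t - t0)) *\<^sub>R J (z x0 t)"
    \<comment> \<open>Polarization: 4 S \<bullet> A is |S + A|^2 - |S - A|^2, and S + A is
      G.\<close>
    have "0 \<le> (S - A) \<bullet> (S - A)" by simp
    then have SA: "S \<bullet> A \<le> (norm (G x0 t))^2 / 4"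
      unfolding G[OF x0 t] S_def[symmetric] A_def[symmetric] power2_norm_eq_inner
      by (simp add: inner_add_left inner_add_right inner_diff_left inner_diff_right inner_commute)
    \<comment> \<open>The multiples of |zx|^2 and |z|^2 by which \<open>qx\<close> falls short of S
      \<bullet> A are the commutator; the second, of order \<tau>^3, is the gain of the
      estimate.\<close>
    have "S \<bullet> A = qx x0 t + 4 * \<tau> * (zx x0 t \<bullet> zx x0 t) + 16 * \<tau>^3 * (R - x0)^2 * (z x0 t \<bullet> z x0 t)
       + 8 * \<tau> * (R - x0) * (J (zt x0 t) \<bullet> zx x0 t) - 4 * \<tau> * (J (zt x0 t) \<bullet> z x0 t)
       + 8 * \<tau> * \<beta> * (t - t0) * (zt x0 t \<bullet> z x0 t)"
      unfolding S_def A_def qx_def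
      by (simp add: inner_add_left inner_add_right inner_diff_left inner_diff_right inner_commute
          algebra_simps power2_eq_square power3_eq_cube)
    then have "E t = S \<bullet> A - 4 * \<tau> * (zx x0 t \<bullet> zx x0 t)
       + (4 * \<tau> * \<beta> - 16 * \<tau>^3 * (R - x0)^2) * (z x0 t \<bullet> z x0 t)"
      unfolding E_def by (simp add: algebra_simps)
    moreover have "0 \<le> 4 * \<tau> * (zx x0 t \<bullet> zx x0 t)"
      using \<tau> by simp
    ultimately show "E t \<le> (norm (G x0 t))^2 / 4
      + (4 * \<tau> * \<beta> - 16 * \<tau>^3 * (R - x0)^2) * (z x0 t \<bullet> z x0 t)"
      using SA by linarith
  qed
  finally show ?thesis
    using Q_deriv by blast
qed

section \<open>Unique continuation\<close>

text \<open>This profile is C^1 but not C^2 at 0. It shapes a compactly supported cutoff in time, of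
  which only the first derivative is taken.\<close>

lemma has_real_derivative_max_0_squared:
  "((\<lambda>r. (max 0 r)\<^sup>2) has_real_derivative 2 * max 0 r) (at (r::real))"
proof -
  consider "r < 0" | "r = 0" | "0 < r" by linarith
  then show ?thesis
  proof cases
    case 1
    have "((\<lambda>r. 0) has_real_derivative 2 * max 0 r) (at r)"
      using 1 by (auto intro!: derivative_eq_intros)
    then show ?thesis
      by (rule has_field_derivative_transform_within_open[of _ _ _ "{..<0}"]) (use 1 in auto)
  next
    case 2
    \<comment> \<open>Caratheodory's slope function at 0 is max 0 z, since (max 0 z)^2 is z times
      max 0 z.\<close>
    have "\<exists>g. (\<forall>z. (max 0 z)\<^sup>2 - (max 0 r)\<^sup>2 = g z * (z - r)) \<and> isCont g r \<and> g r = 2 * max 0 r"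
    proof (intro exI[of _ "\<lambda>z. max 0 z"] conjI allI)
      show "isCont (\<lambda>z. max 0 z) r"
        by (intro continuous_intros)
    qed (use 2 in \<open>auto simp: max_def power2_eq_square\<close>)
    then show ?thesis
      unfolding CARAT_DERIV .
  next
    case 3
    have "((\<lambda>r. r\<^sup>2) has_real_derivative 2 * max 0 r) (at r)"
      using 3 by (auto intro!: derivative_eq_intros)
    then show ?thesis
      by (rule has_field_derivative_transform_within_open[of _ _ _ "{0<..}"]) (use 3 in auto)
  qed
qed

lemma integral_ge_const:
  fixes f :: "real \<Rightarrow> real"
  assumes "continuous_on {c..d} f" "c \<le> d" "\<And>t. t \<in> {c..d} \<Longrightarrow> k \<le> f t"
  shows "k * (d - c) \<le> integral {c..d} f"
proof -
  have "integral {c..d} (\<lambda>_. k) \<le> integral {c..d} f"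
    by (rule integral_le) (use integrable_continuous_real[OF assms(1)] assms(3) in auto)
  then show ?thesis
    using assms(2) by (simp add: mult.commute)
qed

lemma integral_ge_on_subinterval:
  fixes f :: "real \<Rightarrow> real"
  assumes "continuous_on {c..d} f" "\<And>t. t \<in> {c..d} \<Longrightarrow> 0 \<le> f t"
    and "p \<le> q" "{p..q} \<subseteq> {c..d}" "\<And>t. t \<in> {p..q} \<Longrightarrow> k \<le> f t"
  shows "k * (q - p) \<le> integral {c..d} f"
proof -
  have "k * (q - p) \<le> integral {p..q} f"
    by (rule integral_ge_const[OF continuous_on_subset[OF assms(1,4)] assms(3,5)])
  also have "\<dots> \<le> integral {c..d} f"
    by (rule integral_subset_le[OF assms(4)])
      (use assms(2) integrable_continuous_real[OF assms(1)]
        integrable_continuous_real[OF continuous_on_subset[OF assms(1,4)]] in auto)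
  finally show ?thesis .
qed

lemma continuous_on_imp_bounded_curried:
  assumes "compact A" "compact T" "continuous_on (A \<times> T) (\<lambda>(x, t). f x t)"
  obtains C where "\<And>x t. x \<in> A \<Longrightarrow> t \<in> T \<Longrightarrow> norm (f x t) \<le> C"
proof -
  have "bounded ((\<lambda>(x, t). f x t) ` (A \<times> T))"
    by (intro compact_imp_bounded compact_continuous_image[OF assms(3)] compact_Times assms)
  then obtain C where C: "\<And>p. p \<in> A \<times> T \<Longrightarrow> norm ((\<lambda>(x, t). f x t) p) \<le> C"
    unfolding bounded_iff by blast
  show thesis
    by (rule that[of C]) (use C in force)
qed

text \<open>
  The weight is \<open>exp (\<tau> ((R - x)\<^sup>2 - \<beta> (t - t\<^sub>0)\<^sup>2))\<close>. The constant \<open>\<beta>\<close> makes the exponent nonpositive for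
  \<open>T/2 \<le> \<bar>t - t\<^sub>0\<bar>\<close>, where the derivative of the cutoff \<open>\<eta>\<close> in time is not bounded by \<open>\<eta>\<close> itself. On
  the edge \<open>x = X\<close> the weight is at most \<open>exp \<tau>\<close>, so that no cutoff in \<open>x\<close> is needed, whereas it is at
  least \<open>exp (2 \<tau>)\<close> near \<open>(x\<^sub>1, t\<^sub>0)\<close>.
\<close>

lemma (in skew_isometry) schroedinger_unique_continuation:
  fixes w wx wxx wt :: "real \<Rightarrow> real \<Rightarrow> 'b" and T x1 t0 :: real
  defines "I \<equiv> {t0 - T - T..t0 + T + T}" and "X \<equiv> x1 + 1"
  assumes T: "0 < T" and K: "0 \<le> K" and x1: "0 \<le> x1"
    and wx: "\<And>x t. x \<in> {0..X} \<Longrightarrow> t \<in> I \<Longrightarrow> ((\<lambda>y. w y t) has_vector_derivative wx x t) (at x within {0..X})"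
    and wxx: "\<And>x t. x \<in> {0..X} \<Longrightarrow> t \<in> I \<Longrightarrow> ((\<lambda>y. wx y t) has_vector_derivative wxx x t) (at x within {0..X})"
    and wt: "\<And>x t. x \<in> {0..X} \<Longrightarrow> t \<in> I \<Longrightarrow> (w x has_vector_derivative wt x t) (at t within I)"
    and cont_w: "continuous_on ({0..X} \<times> I) (\<lambda>(x, t). w x t)"
    and cont_wx: "continuous_on ({0..X} \<times> I) (\<lambda>(x, t). wx x t)"
    and cont_wxx: "continuous_on ({0..X} \<times> I) (\<lambda>(x, t). wxx x t)"
    and cont_wt: "continuous_on ({0..X} \<times> I) (\<lambda>(x, t). wt x t)"
    and ineq: "\<And>x t. x \<in> {0..X} \<Longrightarrow> t \<in> I \<Longrightarrow> norm (wxx x t + 2 *\<^sub>R J (wt x t)) \<le> K * norm (w x t)"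
    and cauchy: "\<And>t. t \<in> I \<Longrightarrow> w 0 t = 0" "\<And>t. t \<in> I \<Longrightarrow> wx 0 t = 0"
  shows "w x1 t0 = 0"
proof (rule ccontr)
  assume w1: "w x1 t0 \<noteq> 0"
  note cw = continuous_on_curried_compose[OF cont_w]
  note cwxx = continuous_on_curried_compose[OF cont_wxx]
  note cwt = continuous_on_curried_compose[OF cont_wt]
  have compact_I: "compact I" by (simp add: I_def)
  have X: "0 \<le> X" "x1 \<in> {0..X}" using x1 by (auto simp: X_def)
  \<comment> \<open>\<open>R\<close> exceeds \<open>X\<close> by 1 and \<open>x1\<close> by 2, so at
    time \<open>t0\<close> the exponent of the weight is \<tau> on the edge x = X and 4 \<tau> at
    \<open>x1\<close>.\<close>
  define R where "R = x1 + 2"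
  define \<beta> where "\<beta> = 4 * R^2 / T^2"
  define c d where "c = t0 - T" and "d = t0 + T"
  have R: "R - X = 1" "0 < R" using x1 by (auto simp: R_def X_def)
  have \<beta>: "0 \<le> \<beta>" by (simp add: \<beta>_def)
  have cd: "c \<le> d" "d - c = 2 * T" using T by (auto simp: c_def d_def)
  have in_I: "t \<in> I" "\<bar>t - t0\<bar> \<le> T" if "t \<in> {c..d}" for t
    using that T by (auto simp: c_def d_def I_def)
  \<comment> \<open>The margin \<open>T\<close> around the support [c, d] of the cutoff plays the
    role of \<delta> in \<open>carleman_energy_derivative\<close>, where it leaves room for time
    shifts.\<close>
  have I_eq: "I = {c - T..d + T}" by (simp add: I_def c_def d_def)
  define \<eta> where "\<eta> t = (max 0 (T^2 - (t - t0)^2))^2" for t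
  define \<eta>' where "\<eta>' t = - (4 * (t - t0) * max 0 (T^2 - (t - t0)^2))" for t
  have \<eta>_deriv: "(\<eta> has_real_derivative \<eta>' t) (at t within S)" for t S
  proof -
    have "((\<lambda>t. (max 0 (T^2 - (t - t0)^2))^2) has_real_derivative
        (2 * max 0 (T^2 - (t - t0)^2)) * (- (2 * (t - t0)))) (at t within S)"
      by (rule DERIV_chain2[OF has_real_derivative_max_0_squared]) (auto intro!: derivative_eq_intros)
    moreover have "(2 * max 0 (T^2 - (t - t0)^2)) * (- (2 * (t - t0))) = \<eta>' t"
      by (simp add: \<eta>'_def algebra_simps)
    ultimately show ?thesis
      unfolding \<eta>_def[abs_def] by simp
  qed
  have \<eta>_cont: "continuous_on S \<eta>" "continuous_on S \<eta>'" for S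
    unfolding \<eta>_def[abs_def] \<eta>'_def[abs_def] by (intro continuous_intros)+
  have \<eta>_zero: "\<eta> t = 0" if "t \<notin> {c<..<d}" for t
  proof -
    have "T \<le> \<bar>t - t0\<bar>" using that by (auto simp: c_def d_def)
    then have "T^2 \<le> (t - t0)^2"
      using T power_mono[of T "\<bar>t - t0\<bar>" 2] by simp
    then show ?thesis by (simp add: \<eta>_def)
  qed
  have sq: "(t - t0)^2 \<le> T^2" if "t \<in> {c..d}" for t
    using power_mono[OF in_I(2)[OF that], of 2] by simp
  have \<eta>'_abs: "\<bar>\<eta>' t\<bar> = 4 * (\<bar>t - t0\<bar> * max 0 (T^2 - (t - t0)^2))" for t
    unfolding \<eta>'_def abs_minus_cancel abs_mult by simp
  have \<eta>_bounds: "0 \<le> \<eta> t" "\<eta> t \<le> T^4" "\<bar>\<eta>' t\<bar> \<le> 4 * T^3" if "t \<in> {c..d}" for t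
  proof -
    show "0 \<le> \<eta> t" by (simp add: \<eta>_def)
    have m: "0 \<le> max 0 (T^2 - (t - t0)^2)" "max 0 (T^2 - (t - t0)^2) \<le> T^2" by auto
    from power_mono[OF m(2,1), of 2] show "\<eta> t \<le> T^4" by (simp add: \<eta>_def)
    have "\<bar>\<eta>' t\<bar> \<le> 4 * (T * T^2)"
      unfolding \<eta>'_abs
      using in_I(2)[OF that] m T by (intro mult_left_mono mult_mono) auto
    then show "\<bar>\<eta>' t\<bar> \<le> 4 * T^3" by (simp add: power3_eq_cube power2_eq_square)
  qed
  obtain M1 where M1: "\<And>x t. x \<in> {0..X} \<Longrightarrow> t \<in> I \<Longrightarrow> norm (w x t) \<le> M1"
    using continuous_on_imp_bounded_curried[OF compact_Icc compact_I cont_w] by blast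
  obtain M2 where M2: "\<And>x t. x \<in> {0..X} \<Longrightarrow> t \<in> I \<Longrightarrow> norm (wx x t) \<le> M2"
    using continuous_on_imp_bounded_curried[OF compact_Icc compact_I cont_wx] by blast
  obtain M3 where M3: "\<And>x t. x \<in> {0..X} \<Longrightarrow> t \<in> I \<Longrightarrow> norm (wt x t) \<le> M3"
    using continuous_on_imp_bounded_curried[OF compact_Icc compact_I cont_wt] by blast
  define M where "M = max 1 (max M1 (max M2 M3))"
  have M: "norm (w x t) \<le> M" "norm (wx x t) \<le> M" "norm (wt x t) \<le> M" if "x \<in> {0..X}" "t \<in> I" for x t
    using M1[OF that] M2[OF that] M3[OF that] by (auto simp: M_def)
  have M0: "0 < M" by (simp add: M_def)

  \<comment> \<open>\<open>K1\<close> and \<open>C0\<close> bound G: the first relative to z for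
    times near \<open>t0\<close>, the second where the weight is at most 1, by inserting \<eta>
    \<le> T^4 and 4 T^3 as bound of its derivative. \<open>P\<close> times exp \<tau> bounds z on
    the edge x = X, and \<open>C3\<close> collects the bounds of the two integrals in
    \<open>Q X\<close>.\<close>
  define K1 where "K1 = K + 6 / T"
  define C0 where "C0 = T^4 * K * M + 8 * T^3 * M"
  define P where "P = T^4 * M"
  define C3 where "C3 = (6 + 12 * \<beta> * T) * P^2 + 4 * (M * P * (T^4 + 4 * T^3 + 2 * \<beta> * T^5))"

  \<comment> \<open>The bound 1/4 gives R - x \<ge> 7/4, and together with \<beta> \<rho> \<le> 1 it
    gives \<beta> (t - t0)^2 \<le> 1/4, so the exponent of the weight is at least 2 \<tau>; the
    bound T/2 keeps \<eta> above T^4 / 2.\<close>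
  obtain \<rho> where \<rho>: "0 < \<rho>" "\<rho> \<le> 1/4" "\<beta> * \<rho> \<le> 1" "\<rho> \<le> T / 2"
    "\<And>x t. x \<in> {x1..x1 + \<rho>} \<Longrightarrow> t \<in> {t0 - \<rho>..t0 + \<rho>} \<Longrightarrow> norm (w x1 t0) / 2 \<le> norm (w x t)"
  proof -
    have "t0 \<in> I" using T by (simp add: I_def)
    then obtain \<delta> where \<delta>: "0 < \<delta>" "\<And>x t. x \<in> {0..X} \<Longrightarrow> t \<in> I \<Longrightarrow> dist (x, t) (x1, t0) < \<delta> \<Longrightarrow>
        dist (w x t) (w x1 t0) < norm (w x1 t0) / 2"
      using cont_w[unfolded continuous_on_iff, rule_format, of "(x1, t0)" "norm (w x1 t0) / 2"] X(2) w1
      by auto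
    define \<rho> where "\<rho> = min (\<delta> / 3) (min (1/4) (min (1 / (1 + \<beta>)) (T / 2)))"
    have \<rho>: "0 < \<rho>" "\<rho> \<le> \<delta> / 3" "\<rho> \<le> 1/4" "\<rho> \<le> 1 / (1 + \<beta>)" "\<rho> \<le> T / 2"
      using \<delta> \<beta> T by (auto simp: \<rho>_def)
    have "\<beta> * \<rho> \<le> \<beta> * (1 / (1 + \<beta>))"
      using \<rho>(4) \<beta> by (intro mult_left_mono)
    also have "\<dots> \<le> 1" using \<beta> by (simp add: field_simps)
    finally have "\<beta> * \<rho> \<le> 1" .
    moreover have "norm (w x1 t0) / 2 \<le> norm (w x t)"
      if xt: "x \<in> {x1..x1 + \<rho>}" "t \<in> {t0 - \<rho>..t0 + \<rho>}" for x t
    proof -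
      have "dist (x, t) (x1, t0) \<le> \<bar>x - x1\<bar> + \<bar>t - t0\<bar>"
        by (simp add: dist_Pair_Pair dist_real_def sqrt_sum_squares_le_sum_abs)
      also have "\<dots> < \<delta>" using xt \<rho> \<delta>(1) by auto
      finally have "dist (w x t) (w x1 t0) < norm (w x1 t0) / 2"
        using xt \<rho> X x1 T by (intro \<delta>(2)) (auto simp: X_def I_def)
      then show ?thesis
        using norm_triangle_ineq2[of "w x1 t0" "w x t"] by (simp add: dist_norm norm_minus_commute)
    qed
    ultimately show thesis
      using \<rho> by (intro that[of \<rho>]) auto
  qed
  define C6 where "C6 = (T^4 / 2 * (norm (w x1 t0) / 2))^2"
  have C6: "0 < C6" using w1 T by (simp add: C6_def)

  \<comment> \<open>Two estimates of \<open>Q X\<close> are compared: from below by sizes on the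
    edge, from above by integrating its derivative. The fourth power of exp \<tau> is the square of
    the weight near (x1, t0).\<close>
  have main: "- (2 * T * C3) * \<tau>^2 * exp \<tau> ^ 2 \<le> 2 * T * C0^2 * X - \<tau>^2 * (C6 * exp \<tau> ^ 4 * (2 * \<rho>)) * \<rho>"
    if \<tau>: "1 \<le> \<tau>" "4 * \<beta> + K1^2 \<le> \<tau>" for \<tau>
  proof -
    define E where "E x t = exp (\<tau> * ((R - x)^2 - \<beta> * (t - t0)^2))" for x t
    define z where "z x t = (E x t * \<eta> t) *\<^sub>R w x t" for x t
    define zx where "zx x t = (E x t * \<eta> t) *\<^sub>R (wx x t - (2 * \<tau> * (R - x)) *\<^sub>R w x t)" for x t
    define zxx where "zxx x t = (E x t * \<eta> t) *\<^sub>R (wxx x t - (4 * \<tau> * (R - x)) *\<^sub>R wx x t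
        + (4 * \<tau>^2 * (R - x)^2 + 2 * \<tau>) *\<^sub>R w x t)" for x t
    define zt where "zt x t = E x t *\<^sub>R (\<eta> t *\<^sub>R wt x t + (\<eta>' t - 2 * \<tau> * \<beta> * (t - t0) * \<eta> t) *\<^sub>R w x t)" for x t
    \<comment> \<open>The conjugated operator applied to \<open>z\<close>. The cutoff contributes
      only the term with \<open>\<eta>'\<close>, as it does not depend on x.\<close>
    define G where "G x t = E x t *\<^sub>R (\<eta> t *\<^sub>R (wxx x t + 2 *\<^sub>R J (wt x t)) + (2 * \<eta>' t) *\<^sub>R J (w x t))" for x t
    have E0: "0 < E x t" for x t by (simp add: E_def)
    have E_cont: "continuous_on S (\<lambda>p. E (fst p) (snd p))" for S
      unfolding E_def by (intro continuous_intros)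
    have E_dx: "((\<lambda>y. E y t * \<eta> t) has_real_derivative - (2 * \<tau> * (R - x)) * (E x t * \<eta> t)) (at x within S)" for x t S
      unfolding E_def by (rule derivative_eq_intros refl)+ (simp add: algebra_simps)
    have E_dt: "((\<lambda>t. E x t * \<eta> t) has_real_derivative E x t * (\<eta>' t - 2 * \<tau> * \<beta> * (t - t0) * \<eta> t)) (at t within S)"
      for x t S
      unfolding E_def by (rule \<eta>_deriv derivative_eq_intros refl)+ (simp add: algebra_simps)
    have cont2: "continuous_on ({0..X} \<times> I) (\<lambda>p. \<eta> (snd p))" "continuous_on ({0..X} \<times> I) (\<lambda>p. \<eta>' (snd p))"
      by (rule continuous_on_compose2[OF \<eta>_cont(1)[of UNIV]] continuous_on_compose2[OF \<eta>_cont(2)[of UNIV]];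
          auto intro!: continuous_intros)+
    have contw2: "continuous_on ({0..X} \<times> I) (\<lambda>p. w (fst p) (snd p))"
      "continuous_on ({0..X} \<times> I) (\<lambda>p. wx (fst p) (snd p))"
      "continuous_on ({0..X} \<times> I) (\<lambda>p. wxx (fst p) (snd p))"
      "continuous_on ({0..X} \<times> I) (\<lambda>p. wt (fst p) (snd p))"
      using cont_w cont_wx cont_wxx cont_wt by (simp_all add: split_def)
    have cont_z: "continuous_on ({0..X} \<times> I) (\<lambda>(x, t). z x t)"
      and cont_zx: "continuous_on ({0..X} \<times> I) (\<lambda>(x, t). zx x t)"
      and cont_zxx: "continuous_on ({0..X} \<times> I) (\<lambda>(x, t). zxx x t)"
      and cont_zt: "continuous_on ({0..X} \<times> I) (\<lambda>(x, t). zt x t)"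
      unfolding split_def z_def zx_def zxx_def zt_def
      by (intro continuous_intros E_cont cont2 contw2)+
    define Q where "Q x = integral {c..d} (\<lambda>t. 2 * \<tau> * (R - x) * (zx x t \<bullet> zx x t) - 2 * \<tau> * (zx x t \<bullet> z x t)
      + 4 * \<tau> * \<beta> * (t - t0) * (zx x t \<bullet> J (z x t)) + 8 * \<tau>^3 * (R - x)^3 * (z x t \<bullet> z x t))
      + 4 * \<tau> * (R - x) * integral {c..d} (\<lambda>t. J (zt x t) \<bullet> z x t)" for x
    have "\<exists>D. (Q has_real_derivative D) (at x within {0..X}) \<and>
        D \<le> integral {c..d} (\<lambda>t. (norm (G x t))^2 / 4 + (4 * \<tau> * \<beta> - 16 * \<tau>^3 * (R - x)^2) * (z x t \<bullet> z x t))"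
      if x: "x \<in> {0..X}" for x
      unfolding Q_def[abs_def]
    proof (rule carleman_energy_derivative[where \<delta> = T and z = z and zx = zx and zxx = zxx
          and zt = zt and c = c and d = d, folded I_eq])
      show "((\<lambda>y. z y t) has_vector_derivative zx x t) (at x within {0..X})" if "x \<in> {0..X}" "t \<in> I" for x t
        unfolding z_def
        by (rule has_vector_derivative_eq_rhs[OF has_vector_derivative_scaleR[OF E_dx wx[OF that]]])
          (simp add: zx_def algebra_simps)
      show "((\<lambda>y. zx y t) has_vector_derivative zxx x t) (at x within {0..X})" if xt: "x \<in> {0..X}" "t \<in> I" for x t
      proof -
        have "((\<lambda>y. 2 * \<tau> * (R - y)) has_real_derivative - (2 * \<tau>)) (at x within {0..X})"
          by (auto intro!: derivative_eq_intros)
        from has_vector_derivative_diff[OF wxx[OF xt] has_vector_derivative_scaleR[OF this wx[OF xt]]]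
        have d: "((\<lambda>y. wx y t - (2 * \<tau> * (R - y)) *\<^sub>R w y t) has_vector_derivative
           wxx x t - ((2 * \<tau> * (R - x)) *\<^sub>R wx x t + (- (2 * \<tau>)) *\<^sub>R w x t)) (at x within {0..X})" .
        show ?thesis
          unfolding zx_def
        proof (rule has_vector_derivative_eq_rhs[OF has_vector_derivative_scaleR[OF E_dx d]])
          show "(E x t * \<eta> t) *\<^sub>R (wxx x t - ((2 * \<tau> * (R - x)) *\<^sub>R wx x t + (- (2 * \<tau>)) *\<^sub>R w x t)) +
            (- (2 * \<tau> * (R - x)) * (E x t * \<eta> t)) *\<^sub>R (wx x t - (2 * \<tau> * (R - x)) *\<^sub>R w x t) = zxx x t"
            unfolding zxx_def
            \<comment> \<open>Pairing with an arbitrary vector turns the identity into one of real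
              arithmetic.\<close>
            by (subst vector_eq_rdot[symmetric])
              (simp add: inner_add_left inner_diff_left algebra_simps power2_eq_square)
        qed
      qed
      show "(z x has_vector_derivative zt x t) (at t within I)" if "x \<in> {0..X}" "t \<in> I" for x t
        unfolding z_def[abs_def]
        by (rule has_vector_derivative_eq_rhs[OF has_vector_derivative_scaleR[OF E_dt wt[OF that]]])
          (simp add: zt_def algebra_simps)
      show "z x t = 0" "zx x t = 0" if "t \<notin> {c<..<d}" for x t
        using \<eta>_zero[OF that] by (simp_all add: z_def zx_def)
      show "G x t = (2 *\<^sub>R J (zt x t) + zxx x t + (4 * \<tau>^2 * (R - x)^2) *\<^sub>R z x t) +
        ((4 * \<tau> * (R - x)) *\<^sub>R zx x t - (2 * \<tau>) *\<^sub>R z x t + (4 * \<tau> * \<beta> * (t - t0)) *\<^sub>R J (z x t))"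
        for x t
        unfolding G_def z_def zx_def zxx_def zt_def
          linear_add[OF linear_J] linear_scale[OF linear_J]
        by (subst vector_eq_rdot[symmetric])
          (simp add: inner_add_left inner_diff_left algebra_simps power2_eq_square)
    qed (use X cd T \<tau> x cont_z cont_zx cont_zxx cont_zt in auto)
    then obtain D where D: "\<And>x. x \<in> {0..X} \<Longrightarrow> (Q has_real_derivative D x) (at x within {0..X})"
      "\<And>x. x \<in> {0..X} \<Longrightarrow>
        D x \<le> integral {c..d} (\<lambda>t. (norm (G x t))^2 / 4 + (4 * \<tau> * \<beta> - 16 * \<tau>^3 * (R - x)^2) * (z x t \<bullet> z x t))"
      using bchoice[of "{0..X}" "\<lambda>x D. (Q has_real_derivative D) (at x within {0..X}) \<and>
        D \<le> integral {c..d} (\<lambda>t. (norm (G x t))^2 / 4 + (4 * \<tau> * \<beta> - 16 * \<tau>^3 * (R - x)^2) * (z x t \<bullet> z x t))"]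
      by blast
    have y: "1 \<le> R - x" "(R - x)^2 \<le> R^2" if "x \<in> {0..X}" for x
      using that R by (auto intro!: power_mono)
    have norm_z: "norm (z x t) = E x t * \<eta> t * norm (w x t)" if "t \<in> {c..d}" for x t
      using \<eta>_bounds(1)[OF that] E0[of x t] by (simp add: z_def abs_mult)
    have z_sq: "z x t \<bullet> z x t = (norm (z x t))^2" for x t
      by (simp add: power2_norm_eq_inner)
    have G_bound: "(norm (G x t))^2 \<le> K1^2 * (z x t \<bullet> z x t) + C0^2"
      if x: "x \<in> {0..X}" and t: "t \<in> {c..d}" for x t
    proof -
      let ?n = "norm (w x t)"
      have "norm (G x t) = E x t * norm (\<eta> t *\<^sub>R (wxx x t + 2 *\<^sub>R J (wt x t)) + (2 * \<eta>' t) *\<^sub>R J (w x t))"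
        using E0[of x t] by (simp add: G_def)
      also have "\<dots> \<le> E x t * (\<eta> t * norm (wxx x t + 2 *\<^sub>R J (wt x t)) + 2 * \<bar>\<eta>' t\<bar> * ?n)"
        using E0[of x t] \<eta>_bounds(1)[OF t]
        by (intro mult_left_mono order_trans[OF norm_triangle_ineq]) (auto simp: norm_J abs_mult)
      also have "\<dots> \<le> E x t * (\<eta> t * (K * ?n) + 2 * \<bar>\<eta>' t\<bar> * ?n)"
        using E0[of x t] \<eta>_bounds(1)[OF t] ineq[OF x in_I(1)[OF t]]
        by (intro mult_left_mono add_right_mono) auto
      finally have g: "norm (G x t) \<le> E x t * (\<eta> t * (K * ?n) + 2 * \<bar>\<eta>' t\<bar> * ?n)" .
      show ?thesis
      proof (cases "\<bar>t - t0\<bar> \<le> T / 2")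
        case True
        define r where "r = T^2 - (t - t0)^2"
        have "(t - t0)^2 \<le> (T / 2)^2"
          using power_mono[OF True, of 2] by simp
        then have r: "3 / 4 * T^2 \<le> r" by (simp add: r_def power_divide)
        then have r0: "0 \<le> r" by (rule order_trans[rotated]) simp
        have "2 * \<bar>\<eta>' t\<bar> = 8 * (\<bar>t - t0\<bar> * r)"
          using r0 by (simp add: \<eta>'_abs r_def)
        also have "\<dots> \<le> 8 * (T / 2 * r)"
          using True r0 by (intro mult_left_mono mult_right_mono) auto
        \<comment> \<open>8 (T/2) = 4 T is below (6/T) (3/4) T^2 = 4.5 T; this is the origin of 6 /
          T in \<open>K1\<close>.\<close>
        also have "\<dots> \<le> 6 / T * (3 / 4 * T^2) * r"
          using T r0 by (simp add: power2_eq_square mult_right_mono)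
        also have "\<dots> \<le> 6 / T * r * r"
          using T r r0 by (intro mult_right_mono mult_left_mono) auto
        also have "\<dots> = 6 / T * \<eta> t"
          using r0 by (simp add: \<eta>_def r_def power2_eq_square)
        finally have \<eta>'_le: "2 * \<bar>\<eta>' t\<bar> \<le> 6 / T * \<eta> t" .
        have "norm (G x t) \<le> E x t * (\<eta> t * (K * ?n) + 6 / T * \<eta> t * ?n)"
          using E0[of x t] by (intro order_trans[OF g] mult_left_mono add_left_mono mult_right_mono \<eta>'_le) auto
        also have "\<dots> = K1 * norm (z x t)"
          by (simp add: norm_z[OF t] K1_def algebra_simps)
        finally have "(norm (G x t))^2 \<le> (K1 * norm (z x t))^2"
          by (intro power_mono) auto
        then show ?thesis
          by (simp add: z_sq power_mult_distrib add_increasing2)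
      next
        case False
        have "R^2 = \<beta> * (T / 2)^2"
          using T by (simp add: \<beta>_def power_divide)
        also have "\<dots> \<le> \<beta> * (t - t0)^2"
          using False \<beta> T power_mono[of "T / 2" "\<bar>t - t0\<bar>" 2] by (intro mult_left_mono) auto
        finally have "(R - x)^2 - \<beta> * (t - t0)^2 \<le> 0"
          using y(2)[OF x] by simp
        then have E1: "E x t \<le> 1"
          using \<tau> by (auto simp: E_def mult_nonneg_nonpos)
        have "norm (G x t) \<le> 1 * (T^4 * (K * M) + 2 * (4 * T^3) * M)"
          using E1 E0[of x t] \<eta>_bounds[OF t] M(1)[OF x in_I(1)[OF t]] K M0 T
          by (intro order_trans[OF g] mult_mono add_mono mult_left_mono) auto
        also have "\<dots> = C0" by (simp add: C0_def)
        finally have "(norm (G x t))^2 \<le> C0^2"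
          by (intro power_mono) auto
        then show ?thesis
          by (simp add: add_increasing)
      qed
    qed
    have cz: "continuous_on {c..d} (z x)" "continuous_on {c..d} (zx x)" "continuous_on {c..d} (zt x)"
      if "x \<in> {0..X}" for x
      using that in_I
      by (auto intro!: continuous_on_curried_compose[OF cont_z, of _ "\<lambda>_. x" "\<lambda>t. t"]
          continuous_on_curried_compose[OF cont_zx, of _ "\<lambda>_. x" "\<lambda>t. t"]
          continuous_on_curried_compose[OF cont_zt, of _ "\<lambda>_. x" "\<lambda>t. t"] continuous_intros)
    define mass where "mass x = integral {c..d} (\<lambda>t. z x t \<bullet> z x t)" for x
    have D_le: "D x \<le> 2 * T * C0^2 - \<tau>^2 * mass x" if x: "x \<in> {0..X}" for x
    proof -
      have zz: "(\<lambda>t. z x t \<bullet> z x t) integrable_on {c..d}"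
        by (intro integrable_continuous_real continuous_intros cz x)
      have "((\<lambda>t. C0^2 - \<tau>^2 * (z x t \<bullet> z x t)) has_integral (d - c) *\<^sub>R C0^2 - \<tau>^2 * mass x) {c..d}"
        unfolding mass_def using has_integral_const_real[of "C0^2" c d] cd
        by (intro has_integral_diff has_integral_mult_right integrable_integral zz) auto
      then have I: "(\<lambda>t. C0^2 - \<tau>^2 * (z x t \<bullet> z x t)) integrable_on {c..d}"
        "integral {c..d} (\<lambda>t. C0^2 - \<tau>^2 * (z x t \<bullet> z x t)) = 2 * T * C0^2 - \<tau>^2 * mass x"
        using cd by (auto simp: integral_unique)
      have "continuous_on {c..d} (\<lambda>t. wxx x t)" "continuous_on {c..d} (\<lambda>t. wt x t)" "continuous_on {c..d} (\<lambda>t. w x t)"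
        using x in_I by (auto intro!: cw[of _ "\<lambda>_. x" "\<lambda>t. t"] cwxx[of _ "\<lambda>_. x" "\<lambda>t. t"]
            cwt[of _ "\<lambda>_. x" "\<lambda>t. t"] continuous_intros)
      then have "continuous_on {c..d} (G x)"
        unfolding G_def E_def by (intro continuous_intros \<eta>_cont)
      then have "(\<lambda>t. (norm (G x t))^2 / 4 + (4 * \<tau> * \<beta> - 16 * \<tau>^3 * (R - x)^2) * (z x t \<bullet> z x t)) integrable_on {c..d}"
        by (intro integrable_continuous_real continuous_intros cz x) auto
      then have "integral {c..d} (\<lambda>t. (norm (G x t))^2 / 4 + (4 * \<tau> * \<beta> - 16 * \<tau>^3 * (R - x)^2) * (z x t \<bullet> z x t))
         \<le> integral {c..d} (\<lambda>t. C0^2 - \<tau>^2 * (z x t \<bullet> z x t))"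
      proof (rule integral_le[OF _ I(1)])
        fix t assume t: "t \<in> {c..d}"
        \<comment> \<open>The second condition on \<tau> gives 4 \<tau> \<beta> \<le> \<tau>^2 and
          K1^2 \<le> \<tau> \<le> \<tau>^2, while R - x \<ge> 1 makes the subtracted commutator term
          at least 16 \<tau>^2.\<close>
        have coeff: "K1^2 / 4 + 4 * \<tau> * \<beta> - 16 * \<tau>^3 * (R - x)^2 \<le> - (\<tau>^2)"
        proof -
          have "4 * \<beta> \<le> \<tau>" "K1^2 \<le> \<tau>" using \<tau>(2) \<beta> zero_le_power2[of K1] by linarith+
          then have "4 * \<tau> * \<beta> \<le> \<tau>^2" "\<tau> * 1 \<le> \<tau>^2" "K1^2 \<le> \<tau>"
            using \<tau>(1) mult_right_mono[of "4 * \<beta>" \<tau> \<tau>] mult_left_mono[of 1 \<tau> \<tau>]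
            by (auto simp: power2_eq_square mult_ac)
          moreover have "\<tau>^2 * (1 * 1) \<le> \<tau>^2 * (\<tau> * (R - x)^2)"
            using \<tau>(1) y(1)[OF x] power_mono[of 1 "R - x" 2] by (intro mult_left_mono mult_mono) auto
          moreover have "16 * \<tau>^3 * (R - x)^2 = 16 * (\<tau>^2 * (\<tau> * (R - x)^2))"
            by (simp add: power2_eq_square power3_eq_cube)
          ultimately show ?thesis
            using \<tau>(1) by linarith
        qed
        have "(norm (G x t))^2 / 4 + (4 * \<tau> * \<beta> - 16 * \<tau>^3 * (R - x)^2) * (z x t \<bullet> z x t)
           \<le> C0^2 / 4 + (K1^2 / 4 + 4 * \<tau> * \<beta> - 16 * \<tau>^3 * (R - x)^2) * (z x t \<bullet> z x t)"
          using G_bound[OF x t] by (simp add: algebra_simps)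
        also have "\<dots> \<le> C0^2 + (- (\<tau>^2)) * (z x t \<bullet> z x t)"
          by (intro add_mono mult_right_mono coeff) auto
        finally show "(norm (G x t))^2 / 4 + (4 * \<tau> * \<beta> - 16 * \<tau>^3 * (R - x)^2) * (z x t \<bullet> z x t)
          \<le> C0^2 - \<tau>^2 * (z x t \<bullet> z x t)" by simp
      qed
      with D(2)[OF x] I(2) show ?thesis by linarith
    qed
    have mass_nonneg: "0 \<le> mass x" if "x \<in> {0..X}" for x
      unfolding mass_def by (rule integral_nonneg)
        (intro integrable_continuous_real continuous_intros cz that, simp)
    have mass_ge: "C6 * exp \<tau> ^ 4 * (2 * \<rho>) \<le> mass x" if x: "x \<in> {x1..x1 + \<rho>}" for x
    proof -
      have xX: "x \<in> {0..X}" using x x1 \<rho> by (auto simp: X_def)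
      have "C6 * exp \<tau> ^ 4 * ((t0 + \<rho>) - (t0 - \<rho>)) \<le> mass x"
        unfolding mass_def
      proof (rule integral_ge_on_subinterval)
        show "continuous_on {c..d} (\<lambda>t. z x t \<bullet> z x t)"
          by (intro continuous_intros cz xX)
        show "{t0 - \<rho>..t0 + \<rho>} \<subseteq> {c..d}"
          using \<rho> T by (auto simp: c_def d_def)
        fix t assume t: "t \<in> {t0 - \<rho>..t0 + \<rho>}"
        then have tcd: "t \<in> {c..d}" using \<rho> T by (auto simp: c_def d_def)
        have s: "\<bar>t - t0\<bar> \<le> \<rho>" using t by auto
        have s2: "(t - t0)^2 \<le> \<rho>^2" using power_mono[OF s, of 2] by simp
        have "\<beta> * (t - t0)^2 \<le> \<beta> * \<rho>^2"
          using s2 \<beta> by (intro mult_left_mono)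
        also have "\<dots> \<le> 1 * \<rho>"
          using mult_right_mono[OF \<rho>(3), of \<rho>] \<rho>(1) by (simp add: power2_eq_square mult.assoc)
        finally have 1: "\<beta> * (t - t0)^2 \<le> 1 / 4" using \<rho> by linarith
        have "7 / 4 \<le> R - x" using x \<rho> by (auto simp: R_def)
        then have "(7 / 4)^2 \<le> (R - x)^2" by (intro power_mono) auto
        then have "2 \<le> (R - x)^2 - \<beta> * (t - t0)^2"
          using 1 by (simp add: power2_eq_square)
        then have "\<tau> * 2 \<le> \<tau> * ((R - x)^2 - \<beta> * (t - t0)^2)"
          using \<tau> by (intro mult_left_mono) auto
        then have E: "exp \<tau> ^ 2 \<le> E x t"
          by (simp add: E_def exp_of_nat2_mult[symmetric])
        have "\<rho>^2 \<le> (T / 2)^2" using \<rho> by (intro power_mono) auto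
        then have r: "3 / 4 * T^2 \<le> T^2 - (t - t0)^2"
          using s2 by (simp add: power_divide)
        then have r': "3 / 4 * T^2 \<le> max 0 (T^2 - (t - t0)^2)" by linarith
        have "T^4 / 2 \<le> (3 / 4 * T^2)^2" using T by (simp add: power_mult_distrib power_divide)
        also have "\<dots> \<le> \<eta> t"
          unfolding \<eta>_def by (rule power_mono[OF r']) simp
        finally have \<eta>: "T^4 / 2 \<le> \<eta> t" .
        have "exp \<tau> ^ 2 * (T^4 / 2) * (norm (w x1 t0) / 2) \<le> norm (z x t)"
          unfolding norm_z[OF tcd] using E \<eta> \<rho>(5)[OF x t] E0[of x t] \<eta>_bounds(1)[OF tcd]
          by (intro mult_mono) auto
        then have "(exp \<tau> ^ 2 * (T^4 / 2) * (norm (w x1 t0) / 2))^2 \<le> (norm (z x t))^2"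
          by (intro power_mono) auto
        then show "C6 * exp \<tau> ^ 4 \<le> z x t \<bullet> z x t"
          by (simp add: z_sq C6_def power_mult_distrib power_divide mult_ac flip: power_mult)
      qed (use \<rho> in auto)
      then show ?thesis by simp
    qed
    have z0: "z 0 t = 0" "zx 0 t = 0" if "t \<in> {c..d}" for t
      using cauchy[OF in_I(1)[OF that]] by (simp_all add: z_def zx_def)
    have int0: "integral {c..d} f = 0" if "\<And>t. t \<in> {c..d} \<Longrightarrow> f t = 0" for f :: "real \<Rightarrow> real"
      using has_integral_is_0[of "{c..d}" f] that by (simp add: integral_unique)
    \<comment> \<open>Every term of \<open>Q\<close> carries a factor \<open>z\<close> or
      \<open>zx\<close>, so the Cauchy data suffice.\<close>
    have Q0: "Q 0 = 0"
      unfolding Q_def by (subst (1 2) int0) (simp_all add: z0)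
    have D_le': "D x \<le> 2 * T * C0^2" if "x \<in> {0..X}" for x
      using D_le[OF that] mult_nonneg_nonneg[OF zero_le_power2 mass_nonneg[OF that], of \<tau>] by linarith
    \<comment> \<open>The derivative is integrated over three pieces of [0, X]; the loss caused by
      \<open>mass\<close> is kept only on the piece next to \<open>x1\<close>.\<close>
    have "Q x1 - Q 0 \<le> (2 * T * C0^2) * (x1 - 0)"
    proof (rule has_real_derivative_le_imp_diff_le[where S = "{0..X}", OF _ _ D(1)])
      show "D x \<le> 2 * T * C0^2" if "x \<in> {0..x1}" for x
        using that by (intro D_le') (auto simp: X_def)
    qed (use x1 in \<open>auto simp: X_def\<close>)
    moreover have "Q (x1 + \<rho>) - Q x1 \<le> (2 * T * C0^2 - \<tau>^2 * (C6 * exp \<tau> ^ 4 * (2 * \<rho>))) * ((x1 + \<rho>) - x1)"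
    proof (rule has_real_derivative_le_imp_diff_le[where S = "{0..X}", OF _ _ D(1)])
      show "D x \<le> 2 * T * C0^2 - \<tau>^2 * (C6 * exp \<tau> ^ 4 * (2 * \<rho>))" if "x \<in> {x1..x1 + \<rho>}" for x
      proof -
        have "\<tau>^2 * (C6 * exp \<tau> ^ 4 * (2 * \<rho>)) \<le> \<tau>^2 * mass x"
          using mass_ge[OF that] by (intro mult_left_mono) auto
        then show ?thesis
          using D_le[of x] that x1 \<rho> by (auto simp: X_def)
      qed
    qed (use x1 \<rho> in \<open>auto simp: X_def\<close>)
    moreover have "Q X - Q (x1 + \<rho>) \<le> (2 * T * C0^2) * (X - (x1 + \<rho>))"
    proof (rule has_real_derivative_le_imp_diff_le[where S = "{0..X}", OF _ _ D(1)])
      show "D x \<le> 2 * T * C0^2" if "x \<in> {x1 + \<rho>..X}" for x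
        using that x1 \<rho> by (intro D_le') auto
    qed (use x1 \<rho> in \<open>auto simp: X_def\<close>)
    ultimately have QX_le: "Q X \<le> 2 * T * C0^2 * X - \<tau>^2 * (C6 * exp \<tau> ^ 4 * (2 * \<rho>)) * \<rho>"
      unfolding Q0 by (simp add: algebra_simps)

    have XX: "X \<in> {0..X}" using X by auto
    let ?e = "exp \<tau>"
    have E_X: "E X t \<le> ?e" for t
    proof -
      have "\<tau> * (1 - \<beta> * (t - t0)^2) \<le> \<tau> * 1"
        using \<tau> \<beta> by (intro mult_left_mono) auto
      then show ?thesis by (simp add: E_def R)
    qed
    have E\<eta>: "0 \<le> E X t * \<eta> t" "E X t * \<eta> t \<le> ?e * T^4" if "t \<in> {c..d}" for t
      using E_X[of t] E0[of X t] \<eta>_bounds[OF that] by (auto intro!: mult_mono)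
    have nz: "norm (z X t) \<le> P * ?e" if t: "t \<in> {c..d}" for t
    proof -
      have "norm (z X t) \<le> (?e * T^4) * M"
        unfolding norm_z[OF t] using E\<eta>[OF t] M(1)[OF XX in_I(1)[OF t]] T by (intro mult_mono[of _ _ "norm (w X t)"]) auto
      then show ?thesis by (simp add: P_def mult_ac)
    qed
    have nzx: "norm (zx X t) \<le> 3 * \<tau> * P * ?e" if t: "t \<in> {c..d}" for t
    proof -
      note m = M[OF XX in_I(1)[OF t]]
      have "norm (wx X t - (2 * \<tau>) *\<^sub>R w X t) \<le> M + 2 * \<tau> * M"
        using m \<tau> by (intro order_trans[OF norm_triangle_ineq4 add_mono]) auto
      also have "\<dots> \<le> 3 * \<tau> * M"
        using \<tau> M0 mult_right_mono[of 1 \<tau> M] by (simp add: algebra_simps)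
      finally have "norm (wx X t - (2 * \<tau>) *\<^sub>R w X t) \<le> 3 * \<tau> * M" .
      then have "(E X t * \<eta> t) * norm (wx X t - (2 * \<tau>) *\<^sub>R w X t) \<le> (?e * T^4) * (3 * \<tau> * M)"
        using E\<eta>[OF t] T by (intro mult_mono[of "E X t * \<eta> t"]) auto
      moreover have "norm (zx X t) = (E X t * \<eta> t) * norm (wx X t - (2 * \<tau>) *\<^sub>R w X t)"
        using E\<eta>(1)[OF t] unfolding zx_def R by (simp del: abs_mult)
      ultimately show ?thesis by (simp add: P_def mult_ac)
    qed
    have nzt: "norm (zt X t) \<le> \<tau> * ?e * M * (T^4 + 4 * T^3 + 2 * \<beta> * T^5)" if t: "t \<in> {c..d}" for t
    proof -
      note m = M[OF XX in_I(1)[OF t]]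
      have "\<bar>2 * \<tau> * \<beta> * (t - t0) * \<eta> t\<bar> = 2 * \<tau> * \<beta> * (\<bar>t - t0\<bar> * \<eta> t)"
        using \<tau> \<beta> \<eta>_bounds(1)[OF t] by (simp add: abs_mult)
      also have "\<dots> \<le> 2 * \<tau> * \<beta> * (T * T^4)"
        using in_I(2)[OF t] \<eta>_bounds[OF t] \<tau> \<beta> T by (intro mult_left_mono mult_mono) auto
      finally have "\<bar>\<eta>' t - 2 * \<tau> * \<beta> * (t - t0) * \<eta> t\<bar> \<le> 4 * T^3 + 2 * \<tau> * \<beta> * T^5"
        using \<eta>_bounds(3)[OF t] by (simp add: power_Suc[symmetric] del: power_Suc)
      then have "norm (\<eta> t *\<^sub>R wt X t + (\<eta>' t - 2 * \<tau> * \<beta> * (t - t0) * \<eta> t) *\<^sub>R w X t)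
          \<le> T^4 * M + (4 * T^3 + 2 * \<tau> * \<beta> * T^5) * M"
        using \<eta>_bounds[OF t] m M0 unfolding norm_scaleR
        by (intro order_trans[OF norm_triangle_ineq add_mono]) (auto intro!: mult_mono)
      also have "\<dots> \<le> \<tau> * (T^4 * M) + (\<tau> * (4 * T^3) + 2 * \<tau> * \<beta> * T^5) * M"
        using \<tau> \<beta> T M0 mult_right_mono[OF \<tau>(1), of "T^4 * M"] mult_right_mono[OF \<tau>(1), of "4 * T^3"]
        by (intro add_mono mult_right_mono) auto
      finally have "E X t * norm (\<eta> t *\<^sub>R wt X t + (\<eta>' t - 2 * \<tau> * \<beta> * (t - t0) * \<eta> t) *\<^sub>R w X t)
          \<le> ?e * (\<tau> * (T^4 * M) + (\<tau> * (4 * T^3) + 2 * \<tau> * \<beta> * T^5) * M)"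
        using E_X[of t] by (intro mult_mono[of "E X t"]) auto
      moreover have "norm (zt X t) = E X t * norm (\<eta> t *\<^sub>R wt X t + (\<eta>' t - 2 * \<tau> * \<beta> * (t - t0) * \<eta> t) *\<^sub>R w X t)"
        using E0[of X t] unfolding zt_def by simp
      ultimately show ?thesis by (simp add: algebra_simps)
    qed
    have b_ge: "- (\<tau> * ?e * M * (T^4 + 4 * T^3 + 2 * \<beta> * T^5) * (P * ?e)) \<le> J (zt X t) \<bullet> z X t"
      if t: "t \<in> {c..d}" for t
    proof -
      have "\<bar>J (zt X t) \<bullet> z X t\<bar> \<le> norm (zt X t) * norm (z X t)"
        using Cauchy_Schwarz_ineq2[of "J (zt X t)" "z X t"] by (simp add: norm_J)
      also have "\<dots> \<le> (\<tau> * ?e * M * (T^4 + 4 * T^3 + 2 * \<beta> * T^5)) * (P * ?e)"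
        using nzt[OF t] nz[OF t] order_trans[OF norm_ge_zero nzt[OF t]]
        by (intro mult_mono[of "norm (zt X t)"]) auto
      finally show ?thesis by linarith
    qed
    have q_ge: "- ((6 + 12 * \<beta> * T) * P^2 * \<tau>^2 * ?e^2) \<le>
        2 * \<tau> * (zx X t \<bullet> zx X t) - 2 * \<tau> * (zx X t \<bullet> z X t)
        + 4 * \<tau> * \<beta> * (t - t0) * (zx X t \<bullet> J (z X t)) + 8 * \<tau>^3 * (z X t \<bullet> z X t)"
      if t: "t \<in> {c..d}" for t
    proof -
      define m where "m = (3 * \<tau> * P * ?e) * (P * ?e)"
      have nn: "norm (zx X t) * norm (z X t) \<le> m"
        unfolding m_def using nzx[OF t] nz[OF t] order_trans[OF norm_ge_zero nzx[OF t]]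
        by (intro mult_mono[of "norm (zx X t)"]) auto
      have i: "\<bar>zx X t \<bullet> z X t\<bar> \<le> m" "\<bar>zx X t \<bullet> J (z X t)\<bar> \<le> m"
        using Cauchy_Schwarz_ineq2[of "zx X t" "z X t"] Cauchy_Schwarz_ineq2[of "zx X t" "J (z X t)"] nn
        by (simp_all add: norm_J)
      have 1: "2 * \<tau> * (zx X t \<bullet> z X t) \<le> 2 * \<tau> * m"
        using i(1) \<tau> by (intro mult_left_mono) auto
      have "\<bar>4 * \<tau> * \<beta> * (t - t0) * (zx X t \<bullet> J (z X t))\<bar> = 4 * \<tau> * \<beta> * (\<bar>t - t0\<bar> * \<bar>zx X t \<bullet> J (z X t)\<bar>)"
        using \<tau> \<beta> by (simp add: abs_mult)
      also have "\<dots> \<le> 4 * \<tau> * \<beta> * (T * m)"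
        using in_I(2)[OF t] i(2) \<tau> \<beta> T by (intro mult_left_mono mult_mono) auto
      finally have 2: "- (4 * \<tau> * \<beta> * (T * m)) \<le> 4 * \<tau> * \<beta> * (t - t0) * (zx X t \<bullet> J (z X t))"
        by linarith
      \<comment> \<open>Both terms have the favourable sign and are dropped, so the lower bound
        grows only like \<tau>^2 exp (2 \<tau>).\<close>
      have 3: "0 \<le> 2 * \<tau> * (zx X t \<bullet> zx X t)" "0 \<le> 8 * \<tau>^3 * (z X t \<bullet> z X t)"
        using \<tau> by auto
      have "- ((6 + 12 * \<beta> * T) * P^2 * \<tau>^2 * ?e^2) = - (2 * \<tau> * m) - 4 * \<tau> * \<beta> * (T * m)"
        by (simp add: m_def algebra_simps power2_eq_square)
      with 1 2 3 show ?thesis by linarith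
    qed
    have QX: "Q X = integral {c..d} (\<lambda>t. 2 * \<tau> * (zx X t \<bullet> zx X t) - 2 * \<tau> * (zx X t \<bullet> z X t)
        + 4 * \<tau> * \<beta> * (t - t0) * (zx X t \<bullet> J (z X t)) + 8 * \<tau>^3 * (z X t \<bullet> z X t))
        + 4 * \<tau> * integral {c..d} (\<lambda>t. J (zt X t) \<bullet> z X t)"
      unfolding Q_def R by simp
    have "- ((6 + 12 * \<beta> * T) * P^2 * \<tau>^2 * ?e^2) * (d - c) \<le>
        integral {c..d} (\<lambda>t. 2 * \<tau> * (zx X t \<bullet> zx X t) - 2 * \<tau> * (zx X t \<bullet> z X t)
        + 4 * \<tau> * \<beta> * (t - t0) * (zx X t \<bullet> J (z X t)) + 8 * \<tau>^3 * (z X t \<bullet> z X t))"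
      by (rule integral_ge_const[OF _ cd(1) q_ge]) (intro continuous_intros cz XX)
    moreover have "- (\<tau> * ?e * M * (T^4 + 4 * T^3 + 2 * \<beta> * T^5) * (P * ?e)) * (d - c) \<le>
        integral {c..d} (\<lambda>t. J (zt X t) \<bullet> z X t)"
      by (rule integral_ge_const[OF _ cd(1) b_ge]) (intro continuous_intros cz XX)
    then have "4 * \<tau> * (- (\<tau> * ?e * M * (T^4 + 4 * T^3 + 2 * \<beta> * T^5) * (P * ?e)) * (d - c)) \<le>
        4 * \<tau> * integral {c..d} (\<lambda>t. J (zt X t) \<bullet> z X t)"
      using \<tau> by (intro mult_left_mono) auto
    ultimately have "- ((6 + 12 * \<beta> * T) * P^2 * \<tau>^2 * ?e^2) * (d - c)
        + 4 * \<tau> * (- (\<tau> * ?e * M * (T^4 + 4 * T^3 + 2 * \<beta> * T^5) * (P * ?e)) * (d - c)) \<le> Q X"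
      unfolding QX by (rule add_mono)
    also have "- ((6 + 12 * \<beta> * T) * P^2 * \<tau>^2 * ?e^2) * (d - c)
        + 4 * \<tau> * (- (\<tau> * ?e * M * (T^4 + 4 * T^3 + 2 * \<beta> * T^5) * (P * ?e)) * (d - c))
        = - (2 * T * C3) * \<tau>^2 * ?e^2"
      unfolding cd(2) C3_def by (simp add: algebra_simps power2_eq_square)
    finally show ?thesis
      using QX_le by linarith
  qed
  define C7 where "C7 = 2 * T * C3 + 2 * T * C0^2 * X"
  \<comment> \<open>The last threshold makes C7 at most 2 \<rho>^2 C6 \<tau>, and \<tau> < exp (2
    \<tau>) then contradicts \<open>main\<close>.\<close>
  define \<tau> where "\<tau> = max 1 (max (4 * \<beta> + K1^2) (C7 / (2 * \<rho>^2 * C6)))"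
  have \<tau>: "1 \<le> \<tau>" "4 * \<beta> + K1^2 \<le> \<tau>" "C7 / (2 * \<rho>^2 * C6) \<le> \<tau>"
    by (auto simp: \<tau>_def)
  let ?e = "exp \<tau>"
  have e: "\<tau> < ?e" "1 \<le> ?e" using exp_ge_add_one_self[of \<tau>] \<tau>(1) by linarith+
  have pos: "1 \<le> \<tau>^2 * ?e^2"
    using mult_mono[of 1 "\<tau>^2" 1 "?e^2"] \<tau>(1) e(2) by simp
  \<comment> \<open>Enlarging the constant term to a multiple of \<tau>^2 exp (2 \<tau>) lets this
    factor be cancelled throughout.\<close>
  have "2 * T * C0^2 * X \<le> (2 * T * C0^2 * X) * (\<tau>^2 * ?e^2)"
    using mult_left_mono[OF pos, of "2 * T * C0^2 * X"] T X by simp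
  with main[OF \<tau>(1,2)] have "(\<tau>^2 * ?e^2) * (2 * \<rho>^2 * C6 * ?e^2) \<le> (\<tau>^2 * ?e^2) * C7"
    by (simp add: C7_def algebra_simps power2_eq_square power4_eq_xxxx)
  then have "2 * \<rho>^2 * C6 * ?e^2 \<le> C7"
    using pos by (subst (asm) mult_le_cancel_left_pos) auto
  moreover have "C7 < 2 * \<rho>^2 * C6 * ?e^2"
  proof -
    have "C7 \<le> 2 * \<rho>^2 * C6 * \<tau>"
      using \<tau>(3) C6 \<rho>(1) by (simp add: field_simps)
    also have "\<dots> < 2 * \<rho>^2 * C6 * ?e^2"
    proof (rule mult_strict_left_mono)
      show "\<tau> < ?e^2" using e(1) self_le_power[OF e(2), of 2] by simp
    qed (use C6 \<rho>(1) in auto)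
    finally show ?thesis .
  qed
  ultimately show False by simp
qed

section \<open>Application to the matrix equation\<close>

lemma skew_isometry_cscale_mat: "skew_isometry (cscale_mat \<i> :: complex^'n^'m \<Rightarrow> complex^'n^'m)"
proof (rule skew_isometry.intro)
  show "bounded_linear (cscale_mat \<i> :: complex^'n^'m \<Rightarrow> complex^'n^'m)"
    by (rule bounded_linear_cscale_mat)
  show "cscale_mat \<i> A \<bullet> B = - (A \<bullet> cscale_mat \<i> B)" for A B :: "complex^'n^'m"
    by (simp add: cscale_mat_def map_matrix_def inner_vec_def inner_complex_def sum_negf[symmetric] algebra_simps)
  show "norm (cscale_mat \<i> A) = norm A" for A :: "complex^'n^'m"
    by (simp add: cscale_mat_def map_matrix_def norm_vec_def norm_mult)
qed

lemma matrix_triple_product_bound: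
  obtains C where "0 \<le> C"
    "\<And>(A :: complex^'n^'m) (B :: complex^'n^'m) (D :: complex^'n^'m). norm (A ** adjoint_mat B ** D) \<le> C * (norm A * norm B * norm D)"
proof -
  obtain k1 where k1: "0 < k1"
    "\<And>(A :: complex^'n^'m) (B :: complex^'m^'n). norm (A ** B) \<le> norm A * norm B * k1"
    using bounded_bilinear.pos_bounded[OF bounded_bilinear_matrix_matrix_mult] by blast
  obtain k2 where k2: "0 < k2"
    "\<And>(A :: complex^'m^'m) (B :: complex^'n^'m). norm (A ** B) \<le> norm A * norm B * k2"
    using bounded_bilinear.pos_bounded[OF bounded_bilinear_matrix_matrix_mult] by blast
  obtain k3 where k3: "0 < k3" "\<And>A :: complex^'n^'m. norm (adjoint_mat A) \<le> norm A * k3"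
    using bounded_linear.pos_bounded[OF bounded_linear_adjoint_mat] by blast
  have "norm (A ** adjoint_mat B ** D) \<le> (k1 * k2 * k3) * (norm A * norm B * norm D)"
    for A B D :: "complex^'n^'m"
  proof -
    have "norm (A ** adjoint_mat B ** D) \<le> norm (A ** adjoint_mat B) * norm D * k2"
      by (rule k2)
    also have "\<dots> \<le> (norm A * norm (adjoint_mat B) * k1) * norm D * k2"
      using k2(1) by (intro mult_right_mono k1) auto
    also have "\<dots> \<le> (norm A * (norm B * k3) * k1) * norm D * k2"
      using k1(1) k2(1) by (intro mult_right_mono mult_left_mono k3) auto
    finally show ?thesis by (simp add: mult_ac)
  qed
  with k1(1) k2(1) k3(1) show thesis
    by (intro that[of "k1 * k2 * k3"]) auto
qed

text \<open>Each of the three telescoped products is linear in the difference and has two more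
  factors of norm at most r. The nonlinearity thus becomes a zeroth-order perturbation, as the
  Carleman estimate allows.\<close>

lemma cubic_lipschitz_on_cball:
  assumes "0 \<le> r"
  obtains K where "0 \<le> K" "\<And>A B :: complex^'n^'m. norm A \<le> r \<Longrightarrow> norm B \<le> r \<Longrightarrow>
    norm (cubic A - cubic B) \<le> K * norm (A - B)"
proof -
  obtain C where C: "0 \<le> C"
    "\<And>(A :: complex^'n^'m) (B :: complex^'n^'m) (D :: complex^'n^'m). norm (A ** adjoint_mat B ** D) \<le> C * (norm A * norm B * norm D)"
    by (rule matrix_triple_product_bound) blast
  have "norm (cubic A - cubic B) \<le> (3 * C * r^2) * norm (A - B)"
    if r: "norm A \<le> r" "norm B \<le> r" for A B :: "complex^'n^'m"
  proof -
    have le: "norm X * norm Y \<le> r * r" if "norm X \<le> r" "norm Y \<le> r" for X Y :: "complex^'n^'m"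
      using that assms by (intro mult_mono) auto
    have "norm ((A - B) ** adjoint_mat A ** A) \<le> C * (norm (A - B) * (r * r))"
      "norm (B ** adjoint_mat (A - B) ** A) \<le> C * (norm (A - B) * (r * r))"
      "norm (B ** adjoint_mat B ** (A - B)) \<le> C * (norm (A - B) * (r * r))"
      using C(1) mult_left_mono[OF le[OF r(1) r(1)], of "norm (A - B)"]
        mult_left_mono[OF le[OF r(2) r(1)], of "norm (A - B)"]
        mult_left_mono[OF le[OF r(2) r(2)], of "norm (A - B)"]
      by (auto intro!: order_trans[OF C(2)] mult_left_mono simp: mult_ac)
    then have "norm (cubic A - cubic B) \<le> C * (norm (A - B) * (r * r)) + C * (norm (A - B) * (r * r))
        + C * (norm (A - B) * (r * r))"
      unfolding cubic_diff by (intro norm_triangle_mono)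
    then show ?thesis
      by (simp add: power2_eq_square algebra_simps)
  qed
  with C(1) show thesis
    by (intro that[of "3 * C * r^2"]) auto
qed

lemma continuous_on_cubic:
  fixes f :: "'a::topological_space \<Rightarrow> complex^'n^'m"
  shows "continuous_on S f \<Longrightarrow> continuous_on S (\<lambda>p. cubic (f p))"
  unfolding cubic_def
  by (intro bounded_bilinear.continuous_on[OF bounded_bilinear_matrix_matrix_mult]
      bounded_linear.continuous_on[OF bounded_linear_adjoint_mat])

text \<open>\<open>schroedinger_unique_continuation\<close> needs a time interval on both sides of
  \<open>t0\<close>, which fits into (0, a) whenever \<open>t0\<close> lies inside; in x the
  rectangle may reach as far as wanted, so one application per point suffices.\<close>

lemma dNLS_eq_if_cauchy_data_eq:
  fixes v u :: "real \<times> real \<Rightarrow> complex^'n^'m"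
  assumes v: "v \<in> C_eps a" and u: "u \<in> C_eps a"
    and pde: "solves_dNLS a v" "solves_dNLS a u"
    and cauchy: "\<And>t. t \<in> {0..<a} \<Longrightarrow> v (0, t) = u (0, t)" "\<And>t. t \<in> {0..<a} \<Longrightarrow> ddx v (0, t) = ddx u (0, t)"
    and x1: "0 \<le> x1" and t0: "0 < t0" "t0 < a"
  shows "v (x1, t0) = u (x1, t0)"
proof -
  interpret skew_isometry "cscale_mat \<i> :: complex^'n^'m \<Rightarrow> complex^'n^'m"
    by (rule skew_isometry_cscale_mat)
  \<comment> \<open>A quarter, so that the interval of half-length 2 T stays strictly inside (0,
    a).\<close>
  define T where "T = min t0 (a - t0) / 4"
  define X where "X = x1 + 1"
  define I where "I = {t0 - T - T..t0 + T + T}"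
  have T: "0 < T" "2 * T < t0" "2 * T < a - t0"
    using t0 by (auto simp: T_def min_def)
  have I: "I \<subseteq> {0..<a}" using T by (auto simp: I_def)
  have sub: "{0..X} \<times> I \<subseteq> strip a" using I by (auto simp: strip_def)
  have in_strip: "(x, t) \<in> strip a" if "x \<in> {0..X}" "t \<in> I" for x t
    using that sub by auto
  have compact: "compact ({0..X} \<times> I)"
    by (auto simp: I_def intro!: compact_Times)
  note vc = C_eps_continuous_on[OF v, THEN continuous_on_subset[OF _ sub]]
  note uc = C_eps_continuous_on[OF u, THEN continuous_on_subset[OF _ sub]]
  \<comment> \<open>Multiplying the equation for w_t by \<i> once more and using that its square is
    -1 isolates w_xx.\<close>
  have dxx: "ddx (ddx v) p - ddx (ddx u) p + 2 *\<^sub>R cscale_mat \<i> (ddt a v p - ddt a u p)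
      = 2 *\<^sub>R (cubic (v p) - cubic (u p))" if "p \<in> strip a" for p
    unfolding dNLS_difference[OF pde that] linear_scale[OF linear_J] by simp
  \<comment> \<open>\<open>C_eps\<close> asks only for the existence of w_xx on the whole strip; its
    joint continuity is read off from the equation.\<close>
  have cont_xx: "continuous_on ({0..X} \<times> I) (\<lambda>p. ddx (ddx v) p - ddx (ddx u) p)"
  proof (rule continuous_on_eq)
    show "continuous_on ({0..X} \<times> I) (\<lambda>p. 2 *\<^sub>R (cubic (v p) - cubic (u p))
        - 2 *\<^sub>R cscale_mat \<i> (ddt a v p - ddt a u p))"
      by (intro continuous_intros continuous_on_cubic vc uc)
    show "2 *\<^sub>R (cubic (v p) - cubic (u p)) - 2 *\<^sub>R cscale_mat \<i> (ddt a v p - ddt a u p)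
        = ddx (ddx v) p - ddx (ddx u) p" if "p \<in> {0..X} \<times> I" for p
      using dxx[of p] that sub by (auto simp: algebra_simps)
  qed
  have "bounded (v ` ({0..X} \<times> I) \<union> u ` ({0..X} \<times> I))"
    using compact vc(1) uc(1) by (auto intro!: compact_imp_bounded compact_continuous_image)
  then obtain r where r: "\<And>p. p \<in> {0..X} \<times> I \<Longrightarrow> norm (v p) \<le> r" "\<And>p. p \<in> {0..X} \<times> I \<Longrightarrow> norm (u p) \<le> r"
    unfolding bounded_iff by blast
  have "(0, t0) \<in> {0..X} \<times> I" using x1 T by (auto simp: X_def I_def)
  then have "0 \<le> r" using r(1) norm_ge_zero order_trans by blast
  then obtain K where K: "0 \<le> K" "\<And>A B :: complex^'n^'m. norm A \<le> r \<Longrightarrow> norm B \<le> r \<Longrightarrow>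
      norm (cubic A - cubic B) \<le> K * norm (A - B)"
    by (rule cubic_lipschitz_on_cball) blast
  have "v (x1, t0) - u (x1, t0) = 0"
  proof (rule schroedinger_unique_continuation[where T = T and ?x1.0 = x1 and ?t0.0 = t0 and K = "2 * K" and w = "\<lambda>x t. v (x, t) - u (x, t)"
        and wx = "\<lambda>x t. ddx v (x, t) - ddx u (x, t)" and wxx = "\<lambda>x t. ddx (ddx v) (x, t) - ddx (ddx u) (x, t)"
        and wt = "\<lambda>x t. ddt a v (x, t) - ddt a u (x, t)", folded X_def I_def])
    show "((\<lambda>y. v (y, t) - u (y, t)) has_vector_derivative ddx v (x, t) - ddx u (x, t)) (at x within {0..X})"
      if "x \<in> {0..X}" "t \<in> I" for x t
      by (rule has_vector_derivative_within_subset[of _ _ _ "{0..}"])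
        (auto intro!: has_vector_derivative_diff C_eps_has_ddx[OF v] C_eps_has_ddx[OF u] in_strip[OF that])
    show "((\<lambda>y. ddx v (y, t) - ddx u (y, t)) has_vector_derivative ddx (ddx v) (x, t) - ddx (ddx u) (x, t))
      (at x within {0..X})" if "x \<in> {0..X}" "t \<in> I" for x t
      by (rule has_vector_derivative_within_subset[of _ _ _ "{0..}"])
        (auto intro!: has_vector_derivative_diff C_eps_has_ddxx[OF v] C_eps_has_ddxx[OF u] in_strip[OF that])
    show "((\<lambda>s. v (x, s) - u (x, s)) has_vector_derivative ddt a v (x, t) - ddt a u (x, t)) (at t within I)"
      if "x \<in> {0..X}" "t \<in> I" for x t
      by (rule has_vector_derivative_within_subset[OF _ I])
        (intro has_vector_derivative_diff C_eps_has_ddt[OF v] C_eps_has_ddt[OF u] in_strip[OF that])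
    show "norm (ddx (ddx v) (x, t) - ddx (ddx u) (x, t) + 2 *\<^sub>R cscale_mat \<i> (ddt a v (x, t) - ddt a u (x, t)))
      \<le> 2 * K * norm (v (x, t) - u (x, t))" if "x \<in> {0..X}" "t \<in> I" for x t
      unfolding dxx[OF in_strip[OF that]] using K(2)[OF r(1) r(2), of "(x, t)" "(x, t)"] that by simp
    show "v (0, t) - u (0, t) = 0" "ddx v (0, t) - ddx u (0, t) = 0" if "t \<in> I" for t
      using cauchy[of t] that I by auto
    show "continuous_on ({0..X} \<times> I) (\<lambda>(x, t). v (x, t) - u (x, t))"
      "continuous_on ({0..X} \<times> I) (\<lambda>(x, t). ddx v (x, t) - ddx u (x, t))"
      "continuous_on ({0..X} \<times> I) (\<lambda>(x, t). ddx (ddx v) (x, t) - ddx (ddx u) (x, t))"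
      "continuous_on ({0..X} \<times> I) (\<lambda>(x, t). ddt a v (x, t) - ddt a u (x, t))"
      unfolding split_def prod.collapse by (intro continuous_on_diff vc uc cont_xx)+
  qed (use T K x1 in auto)
  then show ?thesis by simp
qed

theorem theorem3p5:
  fixes a :: real
    and M Mplus :: "'m1::finite \<Rightarrow> 'm2::finite \<Rightarrow> nat \<Rightarrow> real"
    and v u :: "real \<times> real \<Rightarrow> complex^'m2^'m1"
  assumes "0 < a"
    and "\<And>i j k. 0 < M i j k"
    and "\<And>i j k. 0 < Mplus i j k"
    and "\<And>i j. quasi_analytic a (M i j)"
    and "\<And>i j. quasi_analytic a (Mplus i j)"
    and "v \<in> C_eps a" and "u \<in> C_eps a"
    and "solves_dNLS a v" and "solves_dNLS a u"
    and "locally_bounded_in_time a v" and "locally_bounded_in_time a u"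
    and "(\<lambda>t. v (0, t)) \<in> matrix_deriv_class a M"
    and "(\<lambda>t. u (0, t)) \<in> matrix_deriv_class a M"
    and "(\<lambda>t. ddx v (0, t)) \<in> matrix_deriv_class a Mplus"
    and "(\<lambda>t. ddx u (0, t)) \<in> matrix_deriv_class a Mplus"
    and "\<And>x. 0 \<le> x \<Longrightarrow> v (x, 0) = u (x, 0)"
  shows "\<forall>p\<in>strip a. v p = u p"
proof
  note flat = dNLS_difference_flat_at_corner[OF assms(1,6-9,16)]
  \<comment> \<open>Flatness of w with one x-derivative is flatness of w_x of every order, as the
    second Cauchy datum requires.\<close>
  have flat_x: "flat_at_corner 0 N (\<lambda>p. ddx v p - ddx u p)" for N
  proof (rule flat_at_corner_derivative[OF flat, of "a / 2"])
    show "((\<lambda>y. v (y, t) - u (y, t)) has_vector_derivative ddx v (x, t) - ddx u (x, t))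
        (at x within {0..a / 2})" if "(x, t) \<in> square (a / 2)" for x t
      by (rule has_vector_derivative_within_subset[of _ _ _ "{0..}"])
        (use that assms(1) in \<open>auto simp: strip_iff square_def
          intro!: has_vector_derivative_diff C_eps_has_ddx[OF assms(6)] C_eps_has_ddx[OF assms(7)]\<close>)
  qed (use assms(1) in auto)
  have cauchy: "v (0, t) = u (0, t)" "ddx v (0, t) = ddx u (0, t)" if "t \<in> {0..<a}" for t
    using quasi_analytic_matrix_unique[OF assms(1,4,2,12,13) flat_at_corner_flat_at_0[OF flat] that]
      quasi_analytic_matrix_unique[OF assms(1,5,3,14,15) flat_at_corner_flat_at_0[OF flat_x] that]
    by auto
  fix p assume p: "p \<in> strip a"
  obtain x t where xt: "p = (x, t)" "0 \<le> x" "0 \<le> t" "t < a"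
    using p by (cases p) (auto simp: strip_iff)
  show "v p = u p"
  \<comment> \<open>At t = 0 there is no two-sided time interval; the initial condition applies
    there.\<close>
  proof (cases "t = 0")
    case True
    then show ?thesis using assms(16) xt by simp
  next
    case False
    then show ?thesis
      using dNLS_eq_if_cauchy_data_eq[OF assms(6-9) cauchy, of x t] xt by simp
  qed
qed

end
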